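(* Let $F$ be a digraph that is localized and colocalized. If $F$ cooperates, then $rK_1 + F$ cooperates for every integer $r \geq 0$.
   Context: All digraphs are finite, loopless, and between any two distinct vertices at most one of the two possible arcs is present. A digraph is $\mathcal{F}$-free if it has no induced subdigraph isomorphic to a member of $\mathcal{F}$. $\vec{\chi}(D)$ is the dichromatic number (least $k$ such that $V(D)$ partitions into $k$ sets inducing acyclic subdigraphs). $H$ is a hero in $\mathcal{F}$-free digraphs if there is $c$ with $\vec{\chi}(D)\le c$ for every $(\{H\}\cup\mathcal{F})$-free digraph $D$; more generally $H$ is a hero in a class $\mathcal{C}$ of digraphs if $H$-free members of $\mathcal{C}$ have bounded dichromatic number. $K_1$ is the one-vertex digraph, $D_1+D_2$ the disjoint union, $rD$ the disjoint union of $r$ copies of $D$ (with $0D$ empty, so $0K_1+F=F$). $D_1\Rightarrow D_2$ is obtained from $D_1+D_2$ by adding all arcs from $V(D_1)$ to $V(D_2)$; $\Delta(D_1,D_2,D_3)$ is obtained from $D_1+D_2+D_3$ by adding all arcs $d_id_j$, $d_i\in V(D_i)$, $d_j\in V(D_j)$, $(i,j)\in\{(1,2),(2,3),(3,1)\}$; $\Delta(1,1,H)$ means $\Delta(K_1,K_1,H)$. A digraph $D$ is $k$-local (resp. $k$-colocal) if for every vertex $v$ the subdigraph induced by the out-neighbourhood (resp. in-neighbourhood) of $v$ has dichromatic number at most $k$. A digraph $F$ cooperates if $H$ is a hero in $F$-free digraphs whenever (a) $H=K_1$, or (b) $H=H_1\Rightarrow H_2$ with $H_1,H_2$ heroes in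 $F$-free digraphs, or (c) $H=\Delta(1,1,H_1)$ with $H_1$ a hero in $F$-free digraphs. $F$ is localized (resp. colocalized) if for every $r\ge1$ and every digraph $H$ such that $\Delta(1,1,H)$ is a hero in $((r-1)K_1+F)$-free digraphs and $H$ is a hero in $(rK_1+F)$-free digraphs, it holds for every $k\ge1$ that $\Delta(1,1,H)$ is a hero in $k$-local (resp. $k$-colocal) $(rK_1+F)$-free digraphs. *)

theory Defs
  imports
    "Graph_Theory.Pair_Digraph"
    "Graph_Theory.Digraph_Isomorphism"
    "HOL-Library.Disjoint_Sets"
begin

locale oriented_digraph = pair_digraph +
  assumes no_digons: "(u, v) \<in> parcs G \<Longrightarrow> (v, u) \<notin> parcs G"

definition dichromatic_number :: "('a, 'b) pre_digraph \<Rightarrow> nat" where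
  "dichromatic_number D =
     (LEAST k. \<exists>P. partition_on (verts D) P \<and> finite P \<and> card P = k \<and>
        (\<forall>X\<in>P. acyclic (arcs_ends (D \<restriction> X))))"

definition free_of :: "'a pair_pre_digraph \<Rightarrow> 'b pair_pre_digraph \<Rightarrow> bool" where
  "free_of D F \<longleftrightarrow>
     \<not> (\<exists>D'. induced_subgraph D' (with_proj D) \<and> digraph_iso D' (with_proj F))"

text \<open>
  Classes of digraphs are sets of digraphs with natural numbers as vertices: every finite
  digraph has an isomorphic copy of this form, and all notions below are invariant
  under isomorphism.  For the same reason a quantification over all digraphs inside a
  definition ranges over \<^typ>\<open>nat pair_pre_digraph\<close>.
\<close>

definition free_class :: "'f pair_pre_digraph \<Rightarrow> nat pair_pre_digraph set" where
  "free_class F = {D. oriented_digraph D \<and> free_of D F}"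

definition hero_in :: "'h pair_pre_digraph \<Rightarrow> nat pair_pre_digraph set \<Rightarrow> bool" where
  "hero_in H C \<longleftrightarrow> (\<exists>c. \<forall>D\<in>C. free_of D H \<longrightarrow> dichromatic_number (with_proj D) \<le> c)"

definition K1 :: "unit pair_pre_digraph" where
  "K1 = \<lparr> pverts = {()}, parcs = {} \<rparr>"

definition disj_union ::
  "'a pair_pre_digraph \<Rightarrow> 'b pair_pre_digraph \<Rightarrow> ('a + 'b) pair_pre_digraph" (infixr "\<oplus>\<^sub>D" 65) where
  "D1 \<oplus>\<^sub>D D2 =
     \<lparr> pverts = pverts D1 <+> pverts D2,
       parcs = map_prod Inl Inl ` parcs D1 \<union> map_prod Inr Inr ` parcs D2 \<rparr>"

definition copies :: "nat \<Rightarrow> 'a pair_pre_digraph \<Rightarrow> (nat \<times> 'a) pair_pre_digraph" where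
  "copies r D =
     \<lparr> pverts = {..<r} \<times> pverts D,
       parcs = {((i, u), (i, v)) | i u v. i < r \<and> (u, v) \<in> parcs D} \<rparr>"

definition dijoin ::
  "'a pair_pre_digraph \<Rightarrow> 'b pair_pre_digraph \<Rightarrow> ('a + 'b) pair_pre_digraph" (infixr "\<Rightarrow>\<^sub>D" 60) where
  "D1 \<Rightarrow>\<^sub>D D2 =
     \<lparr> pverts = pverts (D1 \<oplus>\<^sub>D D2),
       parcs = parcs (D1 \<oplus>\<^sub>D D2) \<union> Inl ` pverts D1 \<times> Inr ` pverts D2 \<rparr>"

definition Delta ::
  "'a pair_pre_digraph \<Rightarrow> 'b pair_pre_digraph \<Rightarrow> 'c pair_pre_digraph
     \<Rightarrow> ('a + 'b + 'c) pair_pre_digraph" where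
  "Delta D1 D2 D3 =
     (let V1 = Inl ` pverts D1;
          V2 = (Inr \<circ> Inl) ` pverts D2;
          V3 = (Inr \<circ> Inr) ` pverts D3
      in \<lparr> pverts = pverts (D1 \<oplus>\<^sub>D D2 \<oplus>\<^sub>D D3),
           parcs = parcs (D1 \<oplus>\<^sub>D D2 \<oplus>\<^sub>D D3) \<union> V1 \<times> V2 \<union> V2 \<times> V3 \<union> V3 \<times> V1 \<rparr>)"

definition k_local :: "nat \<Rightarrow> 'a pair_pre_digraph \<Rightarrow> bool" where
  "k_local k D \<longleftrightarrow>
     (\<forall>v\<in>pverts D. dichromatic_number (with_proj D \<restriction> {u. (v, u) \<in> parcs D}) \<le> k)"

definition k_colocal :: "nat \<Rightarrow> 'a pair_pre_digraph \<Rightarrow> bool" where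
  "k_colocal k D \<longleftrightarrow>
     (\<forall>v\<in>pverts D. dichromatic_number (with_proj D \<restriction> {u. (u, v) \<in> parcs D}) \<le> k)"

definition cooperates :: "'f pair_pre_digraph \<Rightarrow> bool" where
  "cooperates F \<longleftrightarrow>
     hero_in K1 (free_class F) \<and>
     (\<forall>(H1 :: nat pair_pre_digraph) (H2 :: nat pair_pre_digraph).
        oriented_digraph H1 \<and> oriented_digraph H2 \<and>
        hero_in H1 (free_class F) \<and> hero_in H2 (free_class F) \<longrightarrow>
        hero_in (H1 \<Rightarrow>\<^sub>D H2) (free_class F)) \<and>
     (\<forall>H1 :: nat pair_pre_digraph.
        oriented_digraph H1 \<and> hero_in H1 (free_class F) \<longrightarrow>
        hero_in (Delta K1 K1 H1) (free_class F))"

definition localized :: "'f pair_pre_digraph \<Rightarrow> bool" where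
  "localized F \<longleftrightarrow>
     (\<forall>r\<ge>1. \<forall>H :: nat pair_pre_digraph.
        oriented_digraph H \<and>
        hero_in (Delta K1 K1 H) (free_class (copies (r - 1) K1 \<oplus>\<^sub>D F)) \<and>
        hero_in H (free_class (copies r K1 \<oplus>\<^sub>D F)) \<longrightarrow>
        (\<forall>k\<ge>1. hero_in (Delta K1 K1 H) {D \<in> free_class (copies r K1 \<oplus>\<^sub>D F). k_local k D}))"

definition colocalized :: "'f pair_pre_digraph \<Rightarrow> bool" where
  "colocalized F \<longleftrightarrow>
     (\<forall>r\<ge>1. \<forall>H :: nat pair_pre_digraph.
        oriented_digraph H \<and>
        hero_in (Delta K1 K1 H) (free_class (copies (r - 1) K1 \<oplus>\<^sub>D F)) \<and>
        hero_in H (free_class (copies r K1 \<oplus>\<^sub>D F)) \<longrightarrow>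
        (\<forall>k\<ge>1. hero_in (Delta K1 K1 H) {D \<in> free_class (copies r K1 \<oplus>\<^sub>D F). k_colocal k D}))"

end

theory Submission
  imports Defs
begin

text \<open>
  Induction on \<open>r\<close>: in an \<open>((r + 1)K\<^sub>1 + F)\<close>-free digraph the non-neighbours of every vertex
  induce an \<open>(rK\<^sub>1 + F)\<close>-free digraph, so by the induction hypothesis they have bounded dichromatic
  number and the digraph is nearly a tournament.

  For \<open>H\<^sub>1 \<Rightarrow> H\<^sub>2\<close>, large dichromatic number yields a set of bounded size and large dichromatic
  number.  Every vertex is complete to, or completely dominated by, a part of this set that is
  itself not \<open>c\<close>-colourable, or is a non-neighbour of one of its vertices; this covers the
  digraph by boundedly many sets of bounded dichromatic number.

  For \<open>\<Delta>(1, 1, H)\<close>, one takes a longest list of sets (bags) of large dichromatic number with few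
  arcs from later to earlier bags.  The list cuts the vertex set into zones such that no arc goes
  back by two zones or more, and a zone of large dichromatic number would by (co)localization
  contain three consecutive bags replacing two old ones.
\<close>

text \<open>What makes a nearly complete digraph manageable is a trichotomy: relative to a vertex
  \<open>x\<close>, every vertex is an in-neighbour, an out-neighbour, or one of boundedly
  colourable non-neighbours. Bounds come from covers by few sets, and the obstacle is a
  neighbourhood that is itself large. For joins, a set complete to a copy of
  \<open>H\<^sub>2\<close> contains no \<open>H\<^sub>1\<close> and is therefore small; the set of
  bounded size is needed because the number of its subsets does not depend on the digraph. For
  \<open>\<Delta>(1, 1, H)\<close>, the vertices closing a directed triangle with a given arc
  contain no \<open>H\<close> and are few. This is what makes backward arcs sparse. The induction
  hypothesis enters twice: for the non-neighbours, and as the premise of (co)localization about one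
  isolated vertex less. The number of bags depends on the digraph, which does no harm: between zones
  of equal parity no arc goes back, so they can share one palette.\<close>

section \<open>Acyclic colourings\<close>

text \<open>Colour functions rather than partitions: classes may be empty, so the notion is monotone
  in \<open>k\<close> and \<open>S\<close>. A relation with a set allows passing to subsets without
  building induced subdigraphs.\<close>

definition acyclic_colourable :: "'v rel \<Rightarrow> nat \<Rightarrow> 'v set \<Rightarrow> bool" where
  "acyclic_colourable E k S \<longleftrightarrow>
     (\<exists>f. (\<forall>x\<in>S. f x < k) \<and> (\<forall>i. acyclic (Restr E {x \<in> S. f x = i})))"

lemma acyclic_colourable_mono:
  assumes "acyclic_colourable E k S" "T \<subseteq> S" "k \<le> l"
  shows "acyclic_colourable E l T"
proof -
  obtain f where f: "\<forall>x\<in>S. f x < k" "\<And>i. acyclic (Restr E {x \<in> S. f x = i})"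
    using assms(1) by (auto simp: acyclic_colourable_def)
  have "acyclic (Restr E {x \<in> T. f x = i})" for i
    by (rule acyclic_subset[OF f(2)[of i]]) (use assms(2) in auto)
  then show ?thesis
    unfolding acyclic_colourable_def using f(1) assms(2,3) by (intro exI[of _ f]) force
qed

lemma acyclic_colourable_Restr: "acyclic_colourable (Restr E S) k S = acyclic_colourable E k S"
proof -
  have "Restr (Restr E S) {x \<in> S. P x} = Restr E {x \<in> S. P x}" for P
    by auto
  then show ?thesis by (simp add: acyclic_colourable_def)
qed

lemma acyclic_colourable_converse: "acyclic_colourable (E\<inverse>) k S = acyclic_colourable E k S"
proof -
  have "acyclic (Restr (E\<inverse>) X) = acyclic (Restr E X)" for X
  proof -
    have "Restr (E\<inverse>) X = (Restr E X)\<inverse>" by auto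
    then show ?thesis by simp
  qed
  then show ?thesis by (simp add: acyclic_colourable_def)
qed

lemma acyclic_colourable_empty [simp]: "acyclic_colourable E k {}"
  by (auto simp: acyclic_colourable_def acyclic_def)

lemma acyclic_colourable_Un:
  assumes "acyclic_colourable E k S" "acyclic_colourable E l T"
  shows "acyclic_colourable E (k + l) (S \<union> T)"
proof -
  obtain f where f: "\<forall>x\<in>S. f x < k" "\<And>i. acyclic (Restr E {x \<in> S. f x = i})"
    using assms(1) by (auto simp: acyclic_colourable_def)
  obtain g where g: "\<forall>x\<in>T. g x < l" "\<And>i. acyclic (Restr E {x \<in> T. g x = i})"
    using assms(2) by (auto simp: acyclic_colourable_def)
  define h where "h x = (if x \<in> S then f x else k + g x)" for x
  have "acyclic (Restr E {x \<in> S \<union> T. h x = i})" for i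
  proof (cases "i < k")
    case True
    show ?thesis by (rule acyclic_subset[OF f(2)[of i]]) (use True in \<open>auto simp: h_def split: if_splits\<close>)
  next
    case False
    show ?thesis
      by (rule acyclic_subset[OF g(2)[of "i - k"]]) (use False f(1) in \<open>auto simp: h_def split: if_splits\<close>)
  qed
  moreover have "\<forall>x\<in>S \<union> T. h x < k + l"
    using f(1) g(1) by (auto simp: h_def trans_less_add1)
  ultimately show ?thesis unfolding acyclic_colourable_def by blast
qed

lemma acyclic_colourable_UN:
  assumes "finite I" "\<And>i. i \<in> I \<Longrightarrow> acyclic_colourable E k (S i)"
  shows "acyclic_colourable E (card I * k) (\<Union>i\<in>I. S i)"
  using assms
proof (induction I)
  case (insert i I)
  then show ?case using acyclic_colourable_Un[of E k "S i" "card I * k" "\<Union>i\<in>I. S i"] by simp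
qed simp

text \<open>This is the shape of the covering arguments for joins: one piece per member of a bounded
  witness set, and an exceptional piece for the vertices that behave alike towards all
  witnesses.\<close>

lemma acyclic_colourable_cover:
  assumes "T \<subseteq> (\<Union>i\<in>I. A i) \<union> B" "finite I" "card I \<le> h"
    "\<And>i. i \<in> I \<Longrightarrow> acyclic_colourable E m (A i)" "acyclic_colourable E c B"
  shows "acyclic_colourable E (h * m + c) T"
proof (rule acyclic_colourable_mono[OF _ assms(1)])
  show "acyclic_colourable E (card I * m + c) ((\<Union>i\<in>I. A i) \<union> B)"
    using acyclic_colourable_Un[OF acyclic_colourable_UN[OF assms(2,4)] assms(5)] by simp
  show "card I * m + c \<le> h * m + c" using assms(3) by simp
qed

text \<open>The last colour \<open>k\<close> takes over the name of the missing colour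
  \<open>i\<close>. Contrapositively, on a set that is not \<open>k\<close>-colourable each of
  \<open>k + 1\<close> colours must occur.\<close>

lemma acyclic_colourable_unused_colour:
  assumes "\<And>x. x \<in> S \<Longrightarrow> f x < Suc k" "\<And>j. acyclic (Restr E {x \<in> S. f x = j})"
    and "\<And>x. x \<in> S \<Longrightarrow> f x \<noteq> i" "i < Suc k"
  shows "acyclic_colourable E k S"
  unfolding acyclic_colourable_def
proof (intro exI conjI ballI allI)
  define g where "g x = (if f x = k then i else f x)" for x
  show "g x < k" if "x \<in> S" for x
    using assms(1)[OF that] assms(3)[OF that] assms(4) by (auto simp: g_def)
  show "acyclic (Restr E {x \<in> S. g x = j})" for j
  proof (rule acyclic_subset[OF assms(2)[of "if j = i then k else j"]])
    show "Restr E {x \<in> S. g x = j} \<subseteq> Restr E {x \<in> S. f x = (if j = i then k else j)}"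
      using assms(3) by (auto simp: g_def split: if_splits)
  qed
qed

section \<open>The dichromatic number in terms of colour functions\<close>

lemma arcs_ends_induce_subgraph: "arcs_ends (D \<restriction> X) = Restr (arcs_ends D) X"
  by (auto simp: arcs_ends_conv)

lemma dichromatic_number_le_iff:
  assumes "finite (verts D)" "\<And>x. (x, x) \<notin> arcs_ends D"
  shows "dichromatic_number D \<le> k \<longleftrightarrow> acyclic_colourable (arcs_ends D) k (verts D)"
proof -
  define E where "E = arcs_ends D"
  define V where "V = verts D"
  define Q where "Q n \<longleftrightarrow> (\<exists>P. partition_on V P \<and> finite P \<and> card P = n \<and>
    (\<forall>X\<in>P. acyclic (Restr E X)))" for n
  have d: "dichromatic_number D = (LEAST n. Q n)"
    by (simp add: dichromatic_number_def Q_def E_def V_def arcs_ends_induce_subgraph)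
  have fin: "finite V" and loop: "\<And>x. (x, x) \<notin> E"
    using assms by (auto simp: V_def E_def)
  \<comment> \<open>\<open>LEAST\<close> says something only if some value is admissible; absence of
    loops makes the partition into singletons one.\<close>
  have "Q (card ((\<lambda>x. {x}) ` V))"
    unfolding Q_def
  proof (intro exI conjI)
    show "partition_on V ((\<lambda>x. {x}) ` V)" by (auto simp: partition_on_def disjoint_def)
    show "\<forall>X\<in>(\<lambda>x. {x}) ` V. acyclic (Restr E X)"
    proof safe
      fix x
      have "Restr E {x} = {}" using loop by auto
      then show "acyclic (Restr E {x})" by (simp add: acyclic_def)
    qed
  qed (use fin in auto)
  then have Q: "Q (dichromatic_number D)" unfolding d by (rule LeastI)
  show ?thesis
    unfolding E_def[symmetric] V_def[symmetric]
  proof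
    assume le: "dichromatic_number D \<le> k"
    from Q obtain P where P: "partition_on V P" "finite P" "card P = dichromatic_number D"
      "\<forall>X\<in>P. acyclic (Restr E X)" by (auto simp: Q_def)
    obtain b where b: "bij_betw b P {0..<card P}"
      using ex_bij_betw_finite_nat[OF P(2)] by blast
    define p where "p x = (THE X. X \<in> P \<and> x \<in> X)" for x
    have p: "p x = X" if "X \<in> P" "x \<in> X" for x X
      unfolding p_def using that P(1)
      by (intro the_equality) (auto simp: partition_on_def disjoint_def)
    have VP: "V = \<Union>P" using P(1) by (simp add: partition_on_def)
    have "acyclic (Restr E {x \<in> V. b (p x) = i})" for i
    proof (cases "\<exists>X\<in>P. b X = i")
      case True
      then obtain X where X: "X \<in> P" "b X = i" by blast
      have "{x \<in> V. b (p x) = i} \<subseteq> X"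
        using X b p VP by (auto simp: bij_betw_def inj_on_def)
      then have "Restr E {x \<in> V. b (p x) = i} \<subseteq> Restr E X" by blast
      moreover have "acyclic (Restr E X)" using P(4) X(1) by blast
      ultimately show ?thesis by (rule acyclic_subset[rotated])
    next
      case False
      then have "{x \<in> V. b (p x) = i} = {}" using p VP by auto
      then have "Restr E {x \<in> V. b (p x) = i} = {}" by blast
      then show ?thesis by (simp only:) (simp add: acyclic_def)
    qed
    moreover have "\<forall>x\<in>V. b (p x) < k"
    proof
      fix x assume "x \<in> V"
      then obtain X where "X \<in> P" "x \<in> X" using VP by blast
      then have "b (p x) \<in> {0..<card P}" using p b by (auto simp: bij_betw_def)
      then show "b (p x) < k" using P(3) le by simp
    qed
    ultimately show "acyclic_colourable E k V"
      unfolding acyclic_colourable_def by (intro exI[of _ "\<lambda>x. b (p x)"]) blast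
  next
    assume "acyclic_colourable E k V"
    then obtain f where f: "\<forall>x\<in>V. f x < k" "\<And>i. acyclic (Restr E {x \<in> V. f x = i})"
      by (auto simp: acyclic_colourable_def)
    \<comment> \<open>Parts of a partition are nonempty, so empty colour classes are dropped and
      \<open>P\<close> may have fewer than \<open>k\<close> members.\<close>
    define P where "P = (\<lambda>i. {x \<in> V. f x = i}) ` {..<k} - {{}}"
    have "partition_on V P"
      unfolding partition_on_def disjoint_def P_def using f(1) by auto
    then have "Q (card P)"
      unfolding Q_def using f(2) by (intro exI[of _ P]) (auto simp: P_def)
    then have "dichromatic_number D \<le> card P"
      unfolding d by (rule Least_le)
    also have "card P \<le> card ((\<lambda>i. {x \<in> V. f x = i}) ` {..<k})"
      unfolding P_def by (intro card_mono) auto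
    also have "\<dots> \<le> k" using card_image_le[of "{..<k}"] by fastforce
    finally show "dichromatic_number D \<le> k" .
  qed
qed

section \<open>Excluding a join\<close>

text \<open>Without loops a vertex is its own non-neighbour, so the \<open>N\<close> colours cover
  \<open>v\<close> as well.\<close>

locale sparse_nonneighbours =
  fixes E :: "'v rel" and V :: "'v set" and N :: nat
  assumes finite_V: "finite V"
    and no_digon: "(u, v) \<in> E \<Longrightarrow> (v, u) \<notin> E"
    and nonneighbours: "v \<in> V \<Longrightarrow> acyclic_colourable E N {u \<in> V. (u, v) \<notin> E \<and> (v, u) \<notin> E}"
begin

abbreviation "col \<equiv> acyclic_colourable E"

definition tri :: "'v \<Rightarrow> 'v \<Rightarrow> 'v set" where
  "tri u v = {w \<in> V. (v, w) \<in> E \<and> (w, u) \<in> E}"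

lemma no_loop: "(v, v) \<notin> E"
  using no_digon by blast

end

text \<open>
  An \<open>s\<close>-mountain is a set of at most \<open>mountain_size s\<close> vertices that is not \<open>s\<close>-colourable.
  Call an arc \<open>uv\<close> heavy if \<open>tri u v\<close> contains an \<open>s\<close>-mountain.  A clique of \<open>s + 2\<close> vertices joined
  by heavy arcs, together with the mountains of these arcs, is an \<open>(s + 1)\<close>-mountain: two of
  its vertices receive the same colour, which also occurs in their mountain and closes a
  monochromatic triangle.
\<close>

primrec clique_bound :: "nat \<Rightarrow> nat \<Rightarrow> nat \<Rightarrow> nat \<Rightarrow> nat \<Rightarrow> nat" where
  "clique_bound c h N K 0 = 0"
| "clique_bound c h N K (Suc j) =
     2 * (h * (N + (clique_bound c h N K j + c + h * (N + K))) + c)"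

primrec mountain_bound :: "nat \<Rightarrow> nat \<Rightarrow> nat \<Rightarrow> nat \<Rightarrow> nat" where
  "mountain_bound c h N 0 = 0"
| "mountain_bound c h N (Suc s) = clique_bound c h N (mountain_bound c h N s) (s + 2)"

primrec mountain_size :: "nat \<Rightarrow> nat" where
  "mountain_size 0 = 1"
| "mountain_size (Suc s) = (s + 2) + (s + 2) ^ 2 * mountain_size s"

text \<open>The two heroes enter only here: \<open>X\<close> will be a copy of
  \<open>H\<^sub>2\<close> for sinks and of \<open>H\<^sub>1\<close> for sources, whence the size
  bound \<open>h\<close>. A set \<open>Y\<close> that is not \<open>c\<close>-colourable would
  contain the other hero and complete the join.\<close>

locale no_large_join = sparse_nonneighbours +
  fixes c h :: nat
  assumes small_sink: "S \<subseteq> V \<Longrightarrow> \<not> acyclic_colourable E c S \<Longrightarrow>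
      \<exists>X\<subseteq>S. card X \<le> h \<and> (\<forall>Y\<subseteq>V. Y \<times> X \<subseteq> E \<longrightarrow> acyclic_colourable E c Y)"
    and small_source: "S \<subseteq> V \<Longrightarrow> \<not> acyclic_colourable E c S \<Longrightarrow>
      \<exists>X\<subseteq>S. card X \<le> h \<and> (\<forall>Y\<subseteq>V. X \<times> Y \<subseteq> E \<longrightarrow> acyclic_colourable E c Y)"
begin

text \<open>Reversing all arcs exchanges sinks and sources, so each one-sided bound yields its
  mirror image.\<close>

lemma converse_no_large_join: "no_large_join (E\<inverse>) V N c h"
proof
  show "finite V" by (rule finite_V)
  show "(v, u) \<notin> E\<inverse>" if "(u, v) \<in> E\<inverse>" for u v
    using that no_digon by auto
  show "acyclic_colourable (E\<inverse>) N {u \<in> V. (u, v) \<notin> E\<inverse> \<and> (v, u) \<notin> E\<inverse>}" if "v \<in> V" for v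
    using nonneighbours[OF that] by (simp add: acyclic_colourable_converse conj_commute)
  fix S assume S: "S \<subseteq> V" "\<not> acyclic_colourable (E\<inverse>) c S"
  have eq: "A \<times> B \<subseteq> E\<inverse> \<longleftrightarrow> B \<times> A \<subseteq> E" for A B by auto
  show "\<exists>X\<subseteq>S. card X \<le> h \<and> (\<forall>Y\<subseteq>V. Y \<times> X \<subseteq> E\<inverse> \<longrightarrow> acyclic_colourable (E\<inverse>) c Y)"
    using small_source S by (simp add: acyclic_colourable_converse eq)
  show "\<exists>X\<subseteq>S. card X \<le> h \<and> (\<forall>Y\<subseteq>V. X \<times> Y \<subseteq> E\<inverse> \<longrightarrow> acyclic_colourable (E\<inverse>) c Y)"
    using small_sink S by (simp add: acyclic_colourable_converse eq)
qed

text \<open>Take a sink witness \<open>X\<close> inside \<open>T\<close>. A vertex of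
  \<open>T\<close> that is not complete to \<open>X\<close> is a non-neighbour or an out-neighbour
  of some \<open>x\<close> in \<open>X\<close>, at a cost of \<open>N + k\<close> colours per
  \<open>x\<close>; the vertices complete to \<open>X\<close> cost \<open>c\<close>.\<close>

lemma colourable_of_small_outneighbourhoods:
  assumes "T \<subseteq> V" "\<And>v. v \<in> T \<Longrightarrow> col k {u \<in> T. (v, u) \<in> E}"
  shows "col (h * (N + k) + c) T"
proof (cases "col c T")
  case True
  then show ?thesis by (rule acyclic_colourable_mono) auto
next
  case False
  obtain X where X: "X \<subseteq> T" "card X \<le> h" "\<And>Y. Y \<subseteq> V \<Longrightarrow> Y \<times> X \<subseteq> E \<Longrightarrow> col c Y"
    using small_sink[OF assms(1) False] by blast
  define A where "A x = {u \<in> V. (u, x) \<notin> E \<and> (x, u) \<notin> E} \<union> {u \<in> T. (x, u) \<in> E}" for x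
  define B where "B = {u \<in> T. \<forall>x\<in>X. (u, x) \<in> E}"
  show ?thesis
  proof (rule acyclic_colourable_cover)
    show "T \<subseteq> (\<Union>x\<in>X. A x) \<union> B" using assms(1) by (auto simp: A_def B_def)
    show "finite X" using X(1) assms(1) finite_V by (meson finite_subset)
    show "card X \<le> h" by fact
    show "col (N + k) (A x)" if "x \<in> X" for x
      unfolding A_def using that X(1) assms by (intro acyclic_colourable_Un nonneighbours) auto
    show "col c B" using assms(1) by (intro X(3)) (auto simp: B_def)
  qed
qed

lemma colourable_of_small_inneighbourhoods:
  assumes "T \<subseteq> V" "\<And>v. v \<in> T \<Longrightarrow> col k {u \<in> T. (u, v) \<in> E}"
  shows "col (h * (N + k) + c) T"
proof -
  interpret R: no_large_join "E\<inverse>" V N c h by (rule converse_no_large_join)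
  show ?thesis
    using R.colourable_of_small_outneighbourhoods[of T k] assms
    by (simp add: acyclic_colourable_converse)
qed

text \<open>Split \<open>T\<close> by the side that is small; within each half the neighbourhoods
  only shrink. The resulting bound is the recursion of \<open>clique_bound\<close>.\<close>

lemma colourable_of_small_sides:
  assumes "T \<subseteq> V"
    and "\<And>v. v \<in> T \<Longrightarrow> col k {u \<in> T. (v, u) \<in> E} \<or> col k {u \<in> T. (u, v) \<in> E}"
  shows "col (2 * (h * (N + k) + c)) T"
proof -
  define P where "P = {v \<in> T. col k {u \<in> T. (v, u) \<in> E}}"
  define Q where "Q = {v \<in> T. col k {u \<in> T. (u, v) \<in> E}}"
  have "col (h * (N + k) + c) P"
  proof (rule colourable_of_small_outneighbourhoods)
    show "P \<subseteq> V" using assms(1) by (auto simp: P_def)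
    show "col k {u \<in> P. (v, u) \<in> E}" if "v \<in> P" for v
      using that by (auto simp: P_def intro: acyclic_colourable_mono)
  qed
  moreover have "col (h * (N + k) + c) Q"
  proof (rule colourable_of_small_inneighbourhoods)
    show "Q \<subseteq> V" using assms(1) by (auto simp: Q_def)
    show "col k {u \<in> Q. (u, v) \<in> E}" if "v \<in> Q" for v
      using that by (auto simp: Q_def intro: acyclic_colourable_mono)
  qed
  ultimately have "col ((h * (N + k) + c) + (h * (N + k) + c)) (P \<union> Q)"
    by (rule acyclic_colourable_Un)
  then show ?thesis
    by (rule acyclic_colourable_mono) (use assms(2) in \<open>auto simp: P_def Q_def\<close>)
qed

text \<open>If \<open>A\<close> is not \<open>c\<close>-colourable, it has a sink witness
  \<open>X\<close>. A vertex \<open>u\<close> of \<open>B\<close> that is not complete to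
  \<open>X\<close> is a non-neighbour of some \<open>x\<close> in \<open>X\<close>, or satisfies
  \<open>v \<rightarrow> x \<rightarrow> u \<rightarrow> v\<close> and so lies in
  \<open>tri v x\<close>, which meets \<open>B\<close> in few colours.\<close>

lemma light_neighbourhoods:
  assumes "v \<in> V" "A \<subseteq> {u \<in> V. (v, u) \<in> E}" "B \<subseteq> {u \<in> V. (u, v) \<in> E}"
    and "\<And>u. u \<in> A \<Longrightarrow> col K (tri v u \<inter> B)"
  shows "col c A \<or> col (h * (N + K) + c) B"
proof (cases "col c A")
  case False
  have AV: "A \<subseteq> V" using assms(2) by auto
  then obtain X where X: "X \<subseteq> A" "card X \<le> h" "\<And>Y. Y \<subseteq> V \<Longrightarrow> Y \<times> X \<subseteq> E \<Longrightarrow> col c Y"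
    using small_sink[OF _ False] by blast
  define A' where "A' x = {u \<in> V. (u, x) \<notin> E \<and> (x, u) \<notin> E} \<union> tri v x \<inter> B" for x
  define B' where "B' = {u \<in> B. \<forall>x\<in>X. (u, x) \<in> E}"
  have "col (h * (N + K) + c) B"
  proof (rule acyclic_colourable_cover)
    show "B \<subseteq> (\<Union>x\<in>X. A' x) \<union> B'" using assms(3) by (auto simp: A'_def B'_def tri_def)
    show "finite X" using X(1) AV finite_V by (meson finite_subset)
    show "card X \<le> h" by fact
    show "col (N + K) (A' x)" if "x \<in> X" for x
      unfolding A'_def using that X(1) assms by (intro acyclic_colourable_Un nonneighbours) auto
    show "col c B'" using assms(3) by (intro X(3)) (auto simp: B'_def)
  qed
  then show ?thesis ..
qed simp

text \<open>A Ramsey-type induction on the clique size \<open>j\<close>. The heavy neighbours of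
  \<open>v\<close> contain no heavy clique one smaller and are few by induction; by
  \<open>light_neighbourhoods\<close> the light neighbours are few on at least one side. Hence every
  vertex has a small side.\<close>

lemma colourable_of_no_heavy_clique:
  assumes "S \<subseteq> V" "symp heavy"
    and light: "\<And>u v. u \<in> S \<Longrightarrow> v \<in> S \<Longrightarrow> (u, v) \<in> E \<Longrightarrow> \<not> heavy u v \<Longrightarrow> col K (tri u v \<inter> S)"
    and irrefl: "\<And>u. \<not> heavy u u"
  shows "T \<subseteq> S \<Longrightarrow> \<not> (\<exists>Q\<subseteq>T. card Q = j \<and> pairwise heavy Q) \<Longrightarrow> col (clique_bound c h N K j) T"
proof (induction j arbitrary: T)
  case 0
  then show ?case using pairwise_empty[of heavy] by (metis card.empty empty_subsetI)
next
  case (Suc j)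
  define b where "b = clique_bound c h N K j"
  have fin: "finite T" using Suc.prems(1) assms(1) finite_V by (meson finite_subset)
  have "col (2 * (h * (N + (b + c + h * (N + K))) + c)) T"
  proof (rule colourable_of_small_sides)
    show "T \<subseteq> V" using Suc.prems(1) assms(1) by auto
    fix v assume v: "v \<in> T"
    define H where "H = {u \<in> T. heavy v u}"
    define A where "A = {u \<in> T. (v, u) \<in> E \<and> \<not> heavy v u}"
    define B where "B = {u \<in> T. (u, v) \<in> E \<and> \<not> heavy v u}"
    have H: "col b H"
      unfolding b_def
    proof (rule Suc.IH)
      show "H \<subseteq> S" using Suc.prems(1) by (auto simp: H_def)
      show "\<not> (\<exists>Q\<subseteq>H. card Q = j \<and> pairwise heavy Q)"
      proof
        assume "\<exists>Q\<subseteq>H. card Q = j \<and> pairwise heavy Q"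
        then obtain Q where Q: "Q \<subseteq> H" "card Q = j" "pairwise heavy Q" by blast
        have "finite Q" using Q(1) fin by (auto simp: H_def intro: finite_subset)
        moreover have "v \<notin> Q" using Q(1) irrefl by (auto simp: H_def)
        ultimately have "card (insert v Q) = Suc j" using Q(2) by simp
        moreover have "insert v Q \<subseteq> T" using Q(1) v by (auto simp: H_def)
        moreover have "pairwise heavy (insert v Q)"
          using Q(1,3) \<open>symp heavy\<close> by (auto simp: pairwise_insert H_def dest: sympD)
        ultimately show False using Suc.prems(2) by blast
      qed
    qed
    have "col c A \<or> col (h * (N + K) + c) B"
    proof (rule light_neighbourhoods)
      show "v \<in> V" "A \<subseteq> {u \<in> V. (v, u) \<in> E}" "B \<subseteq> {u \<in> V. (u, v) \<in> E}"
        using v Suc.prems(1) assms(1) by (auto simp: A_def B_def)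
      show "col K (tri v u \<inter> B)" if "u \<in> A" for u
      proof (rule acyclic_colourable_mono)
        show "col K (tri v u \<inter> S)" using that v Suc.prems(1) by (intro light) (auto simp: A_def)
        show "tri v u \<inter> B \<subseteq> tri v u \<inter> S" using Suc.prems(1) by (auto simp: B_def)
      qed simp
    qed
    then show "col (b + c + h * (N + K)) {u \<in> T. (v, u) \<in> E} \<or>
        col (b + c + h * (N + K)) {u \<in> T. (u, v) \<in> E}" (is "?out \<or> ?in")
    proof
      assume "col c A"
      then have "col (b + c) (H \<union> A)" by (rule acyclic_colourable_Un[OF H])
      then have ?out
        by (rule acyclic_colourable_mono) (auto simp: H_def A_def)
      then show "?out \<or> ?in" ..
    next
      assume "col (h * (N + K) + c) B"
      then have "col (b + (h * (N + K) + c)) (H \<union> B)" by (rule acyclic_colourable_Un[OF H])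
      then have ?in
        by (rule acyclic_colourable_mono) (auto simp: H_def B_def)
      then show "?out \<or> ?in" ..
    qed
  qed
  then show ?case by (simp add: b_def)
qed

lemma mountain:
  assumes "S \<subseteq> V" "\<not> col (mountain_bound c h N s) S"
  shows "\<exists>M\<subseteq>S. card M \<le> mountain_size s \<and> \<not> col s M"
  using assms
proof (induction s arbitrary: S)
  case 0
  then obtain x where "x \<in> S" by fastforce
  moreover have "\<not> col 0 {x}" by (simp add: acyclic_colourable_def)
  ultimately show ?case by (intro exI[of _ "{x}"]) auto
next
  case (Suc s)
  define hv where "hv u v \<longleftrightarrow> (u, v) \<in> E \<and> (\<exists>M\<subseteq>tri u v \<inter> S. card M \<le> mountain_size s \<and> \<not> col s M)"
    for u v
  define heavy where "heavy u v \<longleftrightarrow> hv u v \<or> hv v u" for u v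
  have "\<exists>Q\<subseteq>S. card Q = s + 2 \<and> pairwise heavy Q"
  proof (rule ccontr)
    assume "\<not> ?thesis"
    then have "col (clique_bound c h N (mountain_bound c h N s) (s + 2)) S"
    proof (rule colourable_of_no_heavy_clique[OF Suc.prems(1) _ _ _ subset_refl, rotated -1])
      show "symp heavy" by (auto simp: heavy_def symp_def)
      show "\<not> heavy u u" for u using no_loop by (auto simp: heavy_def hv_def)
      show "col (mountain_bound c h N s) (tri u v \<inter> S)" if "(u, v) \<in> E" "\<not> heavy u v" for u v
        using Suc.IH[of "tri u v \<inter> S"] that Suc.prems(1) by (auto simp: heavy_def hv_def)
    qed
    then show False using Suc.prems(2) by simp
  qed
  then obtain Q where Q: "Q \<subseteq> S" "card Q = s + 2" "pairwise heavy Q" by blast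
  have finQ: "finite Q" using Q(2) card_ge_0_finite by force
  define m where "m u v = (SOME M. M \<subseteq> tri u v \<inter> S \<and> card M \<le> mountain_size s \<and> \<not> col s M)" for u v
  have m: "m u v \<subseteq> tri u v \<inter> S" "card (m u v) \<le> mountain_size s" "\<not> col s (m u v)"
    if "hv u v" for u v
    using someI_ex[of "\<lambda>M. M \<subseteq> tri u v \<inter> S \<and> card M \<le> mountain_size s \<and> \<not> col s M"] that
    by (auto simp: m_def hv_def)
  \<comment> \<open>Ordered pairs, because \<open>hv\<close> is directed; there are at most
    \<open>(s + 2) ^ 2\<close> of them, which is the factor in \<open>mountain_size\<close>.\<close>
  define I where "I = {p \<in> Q \<times> Q. hv (fst p) (snd p)}"
  define M where "M = Q \<union> (\<Union>p\<in>I. m (fst p) (snd p))"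
  have "card I \<le> card (Q \<times> Q)" unfolding I_def using finQ by (intro card_mono) auto
  then have cI: "card I \<le> (s + 2) ^ 2" using Q(2) by (simp add: card_cartesian_product power2_eq_square)
  have finI: "finite I" unfolding I_def using finQ by auto
  have "card (\<Union>p\<in>I. m (fst p) (snd p)) \<le> (\<Sum>p\<in>I. card (m (fst p) (snd p)))"
    using finI by (rule card_UN_le)
  also have "\<dots> \<le> card I * mountain_size s"
    using sum_bounded_above[of I "\<lambda>p. card (m (fst p) (snd p))" "mountain_size s"] m(2)
    by (auto simp: I_def)
  also have "\<dots> \<le> (s + 2) ^ 2 * mountain_size s" using cI by simp
  finally have "card M \<le> mountain_size (Suc s)"
    unfolding M_def using card_Un_le[of Q "\<Union>p\<in>I. m (fst p) (snd p)"] Q(2) by simp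
  moreover have "M \<subseteq> S" using Q(1) m(1) by (fastforce simp: M_def I_def)
  moreover have "\<not> col (Suc s) M"
  proof
    assume "col (Suc s) M"
    then obtain f where f: "\<forall>x\<in>M. f x < Suc s" "\<And>i. acyclic (Restr E {x \<in> M. f x = i})"
      by (auto simp: acyclic_colourable_def)
    have "f ` Q \<subseteq> {..<Suc s}" using f(1) by (auto simp: M_def)
    then have "card (f ` Q) \<le> Suc s" using card_mono[of "{..<Suc s}"] by fastforce
    then have "\<not> inj_on f Q" using Q(2) pigeonhole[of f Q] by simp
    then obtain a b where ab: "a \<in> Q" "b \<in> Q" "a \<noteq> b" "f a = f b" by (auto simp: inj_on_def)
    then have "heavy a b" using Q(3) by (auto simp: pairwise_def)
    then obtain u v where uv: "hv u v" "u \<in> Q" "v \<in> Q" "f u = f v" using ab by (auto simp: heavy_def)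
    then have sub: "m u v \<subseteq> M" by (auto simp: M_def I_def)
    \<comment> \<open>Otherwise the mountain of \<open>(u, v)\<close> would avoid one of the
      \<open>s + 1\<close> colours and be \<open>s\<close>-colourable.\<close>
    have "\<exists>w\<in>m u v. f w = f u"
    proof (rule ccontr)
      assume *: "\<not> ?thesis"
      have "col s (m u v)"
      proof (rule acyclic_colourable_unused_colour)
        show "f x < Suc s" if "x \<in> m u v" for x using that sub f(1) by auto
        show "acyclic (Restr E {x \<in> m u v. f x = j})" for j
          by (rule acyclic_subset[OF f(2)[of j]]) (use sub in auto)
        show "f u < Suc s" using f(1) uv by (auto simp: M_def)
        show "f x \<noteq> f u" if "x \<in> m u v" for x using * that by auto
      qed
      then show False using m(3) uv(1) by blast
    qed
    then obtain w where w: "w \<in> m u v" "f w = f u" by blast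
    define R where "R = Restr E {x \<in> M. f x = f u}"
    have "u \<in> M" "v \<in> M" "w \<in> M" using uv sub w by (auto simp: M_def)
    moreover have "(u, v) \<in> E" "(v, w) \<in> E" "(w, u) \<in> E"
      using uv(1) w(1) m(1)[OF uv(1)] by (auto simp: hv_def tri_def)
    ultimately have "(u, v) \<in> R" "(v, w) \<in> R" "(w, u) \<in> R" using uv w by (auto simp: R_def)
    then have "(u, u) \<in> R\<^sup>+" by (meson trancl.simps)
    then show False using f(2)[of "f u"] by (auto simp: acyclic_def R_def)
  qed
  ultimately show ?case by blast
qed

text \<open>The level \<open>2 * c\<close> is chosen for a halving argument: if \<open>v\<close> is
  adjacent to all of \<open>M\<close>, its out- and in-neighbours cover \<open>M\<close>, and they
  cannot both be \<open>c\<close>-colourable. The larger one is a member of \<open>J\<close>, and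
  \<open>J\<close> has at most \<open>2 ^ l\<close> members.\<close>

lemma colourable_V:
  defines "l \<equiv> mountain_size (2 * c)"
  shows "col (mountain_bound c h N (2 * c) + (l * N + 2 ^ l * (2 * c))) V"
proof (cases "col (mountain_bound c h N (2 * c)) V")
  case True
  then show ?thesis by (rule acyclic_colourable_mono) auto
next
  case False
  then obtain M where M: "M \<subseteq> V" "card M \<le> l" "\<not> col (2 * c) M"
    using mountain[OF subset_refl] by (auto simp: l_def)
  have finM: "finite M" using M(1) finite_V by (rule finite_subset)
  define A where "A x = {u \<in> V. (u, x) \<notin> E \<and> (x, u) \<notin> E}" for x
  define J where "J = {X \<in> Pow M. \<not> col c X}"
  define B where "B X = {v \<in> V. {v} \<times> X \<subseteq> E} \<union> {v \<in> V. X \<times> {v} \<subseteq> E}" for X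
  \<comment> \<open>Vertices complete to \<open>X\<close> are complete to the sink witness inside
    \<open>X\<close>, and dually for the source witness; either kind costs \<open>c\<close>.\<close>
  have B: "col (c + c) (B X)" if "X \<in> J" for X
  proof -
    have X: "X \<subseteq> V" "\<not> col c X" using that M(1) by (auto simp: J_def)
    obtain Y where Y: "Y \<subseteq> X" "\<And>Z. Z \<subseteq> V \<Longrightarrow> Z \<times> Y \<subseteq> E \<Longrightarrow> col c Z" using small_sink[OF X] by blast
    obtain Y' where Y': "Y' \<subseteq> X" "\<And>Z. Z \<subseteq> V \<Longrightarrow> Y' \<times> Z \<subseteq> E \<Longrightarrow> col c Z" using small_source[OF X] by blast
    show ?thesis unfolding B_def
    proof (rule acyclic_colourable_Un)
      show "col c {v \<in> V. {v} \<times> X \<subseteq> E}" using Y(1) by (intro Y(2)) auto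
      show "col c {v \<in> V. X \<times> {v} \<subseteq> E}" using Y'(1) by (intro Y'(2)) auto
    qed
  qed
  have "card J \<le> card (Pow M)" unfolding J_def using finM by (intro card_mono) auto
  also have "\<dots> \<le> 2 ^ l" using M(2) finM by (simp add: card_Pow)
  finally have cJ: "card J \<le> 2 ^ l" .
  have "v \<in> (\<Union>x\<in>M. A x) \<union> (\<Union>X\<in>J. B X)" if v: "v \<in> V" for v
  proof (rule ccontr)
    assume *: "\<not> ?thesis"
    define P where "P = {x \<in> M. (v, x) \<in> E}"
    define Q where "Q = {x \<in> M. (x, v) \<in> E}"
    have "M \<subseteq> P \<union> Q" using * v by (auto simp: A_def P_def Q_def)
    moreover have "col c P"
    proof (rule ccontr)
      assume "\<not> col c P"
      then have "P \<in> J" by (auto simp: J_def P_def)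
      moreover have "v \<in> B P" using v by (auto simp: B_def P_def)
      ultimately show False using * by blast
    qed
    moreover have "col c Q"
    proof (rule ccontr)
      assume "\<not> col c Q"
      then have "Q \<in> J" by (auto simp: J_def Q_def)
      moreover have "v \<in> B Q" using v by (auto simp: B_def Q_def)
      ultimately show False using * by blast
    qed
    ultimately have "col (2 * c) M"
      using acyclic_colourable_Un[of E c P c Q] by (auto intro: acyclic_colourable_mono)
    then show False using M(3) by blast
  qed
  then have sub: "V \<subseteq> (\<Union>x\<in>M. A x) \<union> (\<Union>X\<in>J. B X)" by blast
  have "col (2 ^ l * (c + c) + 0) (\<Union>X\<in>J. B X)"
    by (rule acyclic_colourable_cover[where I = J and A = B and B = "{}"]) (use B cJ finM in \<open>auto simp: J_def\<close>)
  then have "col (l * N + (2 ^ l * (c + c) + 0)) V"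
    by (intro acyclic_colourable_cover[OF sub finM M(2)])
      (use M(1) in \<open>auto simp: A_def intro!: nonneighbours\<close>)
  then show ?thesis by (rule acyclic_colourable_mono) (auto simp: mult_2)
qed

end


section \<open>Excluding triangles over a hero\<close>

text \<open>Since \<open>z\<close> never decreases along an arc, a directed cycle stays within one
  layer. All layers, however many, can therefore use the same \<open>m\<close> colours.\<close>

lemma acyclic_colourable_layers:
  fixes z :: "'v \<Rightarrow> nat"
  assumes "\<And>i. acyclic_colourable E m {v \<in> S. z v = i}"
    and "\<And>u v. u \<in> S \<Longrightarrow> v \<in> S \<Longrightarrow> (u, v) \<in> E \<Longrightarrow> z u \<le> z v"
  shows "acyclic_colourable E m S"
proof -
  have "\<forall>i. \<exists>f. (\<forall>x\<in>{v \<in> S. z v = i}. f x < m) \<and>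
      (\<forall>j. acyclic (Restr E {x \<in> {v \<in> S. z v = i}. f x = j}))"
    using assms(1) by (simp only: acyclic_colourable_def) blast
  from choice[OF this] obtain f where f': "\<forall>i. (\<forall>x\<in>{v \<in> S. z v = i}. f i x < m) \<and>
      (\<forall>j. acyclic (Restr E {x \<in> {v \<in> S. z v = i}. f i x = j}))" ..
  have f: "\<And>i x. x \<in> {v \<in> S. z v = i} \<Longrightarrow> f i x < m"
    "\<And>i j. acyclic (Restr E {x \<in> {v \<in> S. z v = i}. f i x = j})"
    using f' by blast+
  define g where "g x = f (z x) x" for x
  have "acyclic (Restr E {x \<in> S. g x = j})" for j
  proof -
    define R where "R = Restr E {x \<in> S. g x = j}"
    define R' where "R' i = Restr E {x \<in> {v \<in> S. z v = i}. f i x = j}" for i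
    have mono: "z a \<le> z b" if "(a, b) \<in> R\<^sup>+" for a b
      using that
    proof induction
      case (step y b)
      then have "z y \<le> z b" using assms(2) by (auto simp: R_def)
      then show ?case using step.IH by simp
    qed (use assms(2) in \<open>auto simp: R_def\<close>)
    have layer: "z b = z a \<Longrightarrow> (a, b) \<in> (R' (z a))\<^sup>+" if "(a, b) \<in> R\<^sup>+" for a b
      using that
    proof induction
      case (base b)
      then have "(a, b) \<in> R' (z a)" by (auto simp: R_def R'_def g_def)
      then show ?case by blast
    next
      case (step y b)
      have "z y \<le> z b" using step.hyps(2) assms(2) by (auto simp: R_def)
      then have zy: "z y = z a" using mono[OF step.hyps(1)] step.prems by simp
      then have "(y, b) \<in> R' (z a)" using step.hyps(2) step.prems by (auto simp: R_def R'_def g_def)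
      then show ?case using step.IH[OF zy] by (rule trancl_into_trancl[rotated])
    qed
    have "(x, x) \<notin> R\<^sup>+" for x
      using layer[of x x] f(2)[where i = "z x" and j = j] by (auto simp: acyclic_def R'_def)
    then show ?thesis by (simp add: acyclic_def R_def)
  qed
  moreover have "\<forall>x\<in>S. g x < m" using f(1) by (auto simp: g_def)
  ultimately show ?thesis unfolding acyclic_colourable_def by blast
qed

text \<open>\<open>c\<close> will be the bound for \<open>H\<close>-free sets, as a copy of
  \<open>H\<close> in \<open>tri u v\<close> would complete \<open>\<Delta>(1, 1, H)\<close>. The
  function \<open>L\<close> comes from localization and colocalization, applied to the subsets of
  \<open>V\<close>.\<close>

locale small_triangles = sparse_nonneighbours +
  fixes c :: nat and L :: "nat \<Rightarrow> nat"
  assumes col_tri: "u \<in> V \<Longrightarrow> v \<in> V \<Longrightarrow> (u, v) \<in> E \<Longrightarrow> acyclic_colourable E c (tri u v)"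
    and col_local: "S \<subseteq> V \<Longrightarrow> (\<And>v. v \<in> S \<Longrightarrow> acyclic_colourable E k {u \<in> S. (v, u) \<in> E}) \<Longrightarrow>
      acyclic_colourable E (L k) S"
    and col_colocal: "S \<subseteq> V \<Longrightarrow> (\<And>v. v \<in> S \<Longrightarrow> acyclic_colourable E k {u \<in> S. (u, v) \<in> E}) \<Longrightarrow>
      acyclic_colourable E (L k) S"
begin

section \<open>Sets with sparse arcs back\<close>

definition before :: "'a set \<Rightarrow> 'a set \<Rightarrow> bool" where
  "before A B \<longleftrightarrow> (\<forall>x\<in>A. col c {u \<in> B. (u, x) \<in> E}) \<and> (\<forall>y\<in>B. col c {u \<in> A. (y, u) \<in> E})"

text \<open>
  This threshold makes a bag too large to precede itself, and too large to be covered by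
  the few small sets that an arc going back over it would leave.
\<close>

definition bag_bound :: nat where
  "bag_bound = max (L c) (4 * c + 3 * N)"

definition chain :: "'a set list \<Rightarrow> bool" where
  "chain Bs \<longleftrightarrow> sorted_wrt before Bs \<and> (\<forall>B\<in>set Bs. B \<subseteq> V \<and> \<not> col bag_bound B)"

lemma before_of_no_arcs: "(\<And>x y. x \<in> A \<Longrightarrow> y \<in> B \<Longrightarrow> (y, x) \<notin> E) \<Longrightarrow> before A B"
proof -
  assume "\<And>x y. x \<in> A \<Longrightarrow> y \<in> B \<Longrightarrow> (y, x) \<notin> E"
  then have "{u \<in> B. (u, x) \<in> E} = {}" "{u \<in> A. (y, u) \<in> E} = {}" if "x \<in> A" "y \<in> B" for x y
    using that by auto
  then show ?thesis unfolding before_def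
    by (cases "A = {} \<or> B = {}") (auto simp del: Collect_empty_eq)
qed

lemma before_subset:
  assumes "before A B" "A' \<subseteq> A" "B' \<subseteq> B"
  shows "before A' B'"
  unfolding before_def
proof (intro conjI ballI)
  show "col c {u \<in> B'. (u, x) \<in> E}" if "x \<in> A'" for x
    by (rule acyclic_colourable_mono[of E c "{u \<in> B. (u, x) \<in> E}"])
      (use assms that in \<open>auto simp: before_def\<close>)
  show "col c {u \<in> A'. (y, u) \<in> E}" if "y \<in> B'" for y
    by (rule acyclic_colourable_mono[of E c "{u \<in> A. (y, u) \<in> E}"])
      (use assms that in \<open>auto simp: before_def\<close>)
qed

lemma not_before_self: "B \<subseteq> V \<Longrightarrow> \<not> col bag_bound B \<Longrightarrow> \<not> before B B"
proof
  assume B: "B \<subseteq> V" "\<not> col bag_bound B" "before B B"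
  have "col (L c) B" using B(1,3) by (intro col_colocal) (auto simp: before_def)
  then have "col bag_bound B" by (rule acyclic_colourable_mono) (auto simp: bag_bound_def)
  then show False using B(2) by simp
qed

text \<open>A repeated bag would precede itself, so bags are distinct. The purpose is the existence
  of a longest chain.\<close>

lemma chain_length: "chain Bs \<Longrightarrow> length Bs \<le> card (Pow V)"
proof -
  assume ch: "chain Bs"
  have "distinct Bs"
  proof (rule ccontr)
    assume "\<not> distinct Bs"
    then obtain i j where ij: "i < length Bs" "j < length Bs" "i < j" "Bs ! i = Bs ! j"
      unfolding distinct_conv_nth by (metis linorder_neqE_nat)
    then have "before (Bs ! i) (Bs ! i)"
      using ch sorted_wrt_nth_less[of before Bs i j] by (auto simp: chain_def)
    moreover have "Bs ! i \<subseteq> V" "\<not> col bag_bound (Bs ! i)"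
      using ch ij(1) nth_mem by (auto simp: chain_def)
    ultimately show False using not_before_self by blast
  qed
  then have "length Bs = card (set Bs)" by (simp add: distinct_card)
  also have "\<dots> \<le> card (Pow V)"
    using ch finite_V by (intro card_mono) (auto simp: chain_def)
  finally show ?thesis .
qed

text \<open>By the two local bounds some \<open>v\<close> in \<open>S\<close> has both
  neighbourhoods large; these are \<open>A\<close> (in) and \<open>B\<close> (out). An arc from
  \<open>u\<close> in \<open>B\<close> back to \<open>x\<close> in \<open>A\<close> closes the
  triangle \<open>x \<rightarrow> v \<rightarrow> u \<rightarrow> x\<close>, so the backward
  neighbours of a single vertex lie in one set \<open>tri x v\<close> or
  \<open>tri v u\<close>.\<close>

lemma before_pair:
  assumes "S \<subseteq> V" "\<not> col (2 * L m) S"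
  shows "\<exists>A B. A \<subseteq> S \<and> B \<subseteq> S \<and> \<not> col m A \<and> \<not> col m B \<and> before A B"
proof -
  define P where "P = {v \<in> S. col m {u \<in> S. (v, u) \<in> E}}"
  define Q where "Q = {v \<in> S. col m {u \<in> S. (u, v) \<in> E}}"
  have "col (L m) P"
  proof (rule col_local)
    show "P \<subseteq> V" using assms(1) by (auto simp: P_def)
    show "col m {u \<in> P. (v, u) \<in> E}" if "v \<in> P" for v
      using that by (auto simp: P_def intro: acyclic_colourable_mono)
  qed
  moreover have "col (L m) Q"
  proof (rule col_colocal)
    show "Q \<subseteq> V" using assms(1) by (auto simp: Q_def)
    show "col m {u \<in> Q. (u, v) \<in> E}" if "v \<in> Q" for v
      using that by (auto simp: Q_def intro: acyclic_colourable_mono)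
  qed
  ultimately have PQ: "col (2 * L m) (P \<union> Q)"
    using acyclic_colourable_Un by (fastforce simp: mult_2)
  have "\<not> S \<subseteq> P \<union> Q" using acyclic_colourable_mono[OF PQ] assms(2) by blast
  then obtain v where v: "v \<in> S" "v \<notin> P" "v \<notin> Q" by blast
  define A where "A = {u \<in> S. (u, v) \<in> E}"
  define B where "B = {u \<in> S. (v, u) \<in> E}"
  have "before A B"
    unfolding before_def
  proof (intro conjI ballI)
    fix x assume "x \<in> A"
    then have "col c (tri x v)" using v(1) assms(1) by (intro col_tri) (auto simp: A_def)
    then show "col c {u \<in> B. (u, x) \<in> E}"
      by (rule acyclic_colourable_mono) (use assms(1) in \<open>auto simp: B_def tri_def\<close>)
  next
    fix y assume "y \<in> B"
    then have "col c (tri v y)" using v(1) assms(1) by (intro col_tri) (auto simp: B_def)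
    then show "col c {u \<in> A. (y, u) \<in> E}"
      by (rule acyclic_colourable_mono) (use assms(1) in \<open>auto simp: A_def tri_def\<close>)
  qed
  moreover have "\<not> col m A" "\<not> col m B" using v by (auto simp: P_def Q_def A_def B_def)
  moreover have "A \<subseteq> S" "B \<subseteq> S" by (auto simp: A_def B_def)
  ultimately show ?thesis by blast
qed

text \<open>Split twice: at level \<open>2 * L m + m\<close> the second set is large enough to be
  split again, and the first one is still not \<open>m\<close>-colourable.\<close>

lemma before_triple:
  assumes "S \<subseteq> V" "\<not> col (2 * L (2 * L m + m)) S"
  shows "\<exists>A B C. sorted_wrt before [A, B, C] \<and> (\<forall>X\<in>{A, B, C}. X \<subseteq> S \<and> \<not> col m X)"
proof -
  obtain A D where AD: "A \<subseteq> S" "D \<subseteq> S" "\<not> col (2 * L m + m) A" "\<not> col (2 * L m + m) D" "before A D"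
    using before_pair[OF assms] by blast
  have "\<not> col m A" "\<not> col (2 * L m) D" "D \<subseteq> V"
    using AD assms(1) acyclic_colourable_mono[OF _ subset_refl] by (meson le_add1 le_add2 subset_trans)+
  moreover obtain B C where "B \<subseteq> D" "C \<subseteq> D" "\<not> col m B" "\<not> col m C" "before B C"
    using before_pair[OF \<open>D \<subseteq> V\<close> \<open>\<not> col (2 * L m) D\<close>] by blast
  ultimately show ?thesis
    using AD before_subset[OF AD(5) subset_refl] by (intro exI[of _ A] exI[of _ B] exI[of _ C]) auto
qed

section \<open>Zones of a longest chain\<close>

definition longest_chain :: "'a set list \<Rightarrow> bool" where
  "longest_chain Bs \<longleftrightarrow> chain Bs \<and> (\<forall>Cs. chain Cs \<longrightarrow> length Cs \<le> length Bs)"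

lemma ex_longest_chain: "\<exists>Bs. longest_chain Bs"
proof -
  have "chain []" by (simp add: chain_def)
  moreover have "\<forall>Cs. chain Cs \<longrightarrow> length Cs < Suc (card (Pow V))" using chain_length by (simp add: less_Suc_eq_le)
  ultimately show ?thesis
    unfolding longest_chain_def by (rule ex_has_greatest_nat)
qed

text \<open>Vertices sending no arc into any bag form the last zone, with index \<open>length Bs\<close>.\<close>

definition zone :: "'a set list \<Rightarrow> 'a \<Rightarrow> nat" where
  "zone Bs v = (LEAST i. i < length Bs \<longrightarrow> (\<exists>w\<in>Bs ! i. (v, w) \<in> E))"

lemma zone_le: "zone Bs v \<le> length Bs"
  unfolding zone_def by (rule Least_le) simp

lemma zone_outneighbour: "zone Bs v < length Bs \<Longrightarrow> \<exists>w\<in>Bs ! zone Bs v. (v, w) \<in> E"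
  unfolding zone_def by (rule LeastI[of _ "length Bs", THEN mp]) simp_all

lemma no_arc_into_earlier_bag: "j < zone Bs v \<Longrightarrow> w \<in> Bs ! j \<Longrightarrow> (v, w) \<notin> E"
  using not_less_Least[of j "\<lambda>i. i < length Bs \<longrightarrow> (\<exists>w\<in>Bs ! i. (v, w) \<in> E)"]
  by (auto simp: zone_def)

context
  fixes Bs assumes ch: "chain Bs"
begin

lemma bag: "j < length Bs \<Longrightarrow> Bs ! j \<subseteq> V" "j < length Bs \<Longrightarrow> \<not> col bag_bound (Bs ! j)"
  using ch by (auto simp: chain_def)

lemma bag_before: "i < j \<Longrightarrow> j < length Bs \<Longrightarrow> before (Bs ! i) (Bs ! j)"
  using ch sorted_wrt_nth_less[of before Bs i j] by (auto simp: chain_def)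

lemma not_covered_bag:
  assumes "j < length Bs" "Bs ! j \<subseteq> X" "col k X" "k \<le> 4 * c + 3 * N"
  shows False
  using acyclic_colourable_mono[OF assms(3,2), of bag_bound] bag(2)[OF assms(1)] assms(4)
  by (simp add: bag_bound_def)

text \<open>By the definition of its zone, \<open>v\<close> has an out-neighbour \<open>w\<close> in
  an earlier bag. An in-neighbour \<open>u\<close> of \<open>v\<close> in bag \<open>j\<close> sends
  an arc back to \<open>w\<close>, is a non-neighbour of \<open>w\<close>, or closes the triangle
  \<open>v \<rightarrow> w \<rightarrow> u \<rightarrow> v\<close>.\<close>

lemma few_inneighbours_in_later_bag:
  assumes "v \<in> V" "zone Bs v < j" "j < length Bs"
  shows "col (2 * c + N) {u \<in> Bs ! j. (u, v) \<in> E}"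
proof -
  have z: "zone Bs v < length Bs" using assms by simp
  obtain w where w: "w \<in> Bs ! zone Bs v" "(v, w) \<in> E"
    using zone_outneighbour[OF z] by blast
  have wV: "w \<in> V" using w(1) bag(1)[OF z] by blast
  have "col c (tri v w)" using col_tri assms(1) wV w(2) .
  moreover have "col c {u \<in> Bs ! j. (u, w) \<in> E}"
    using bag_before[OF assms(2,3)] w(1) by (auto simp: before_def)
  moreover note nonneighbours[OF wV]
  ultimately have "col (c + c + N) (tri v w \<union> {u \<in> Bs ! j. (u, w) \<in> E} \<union> {u \<in> V. (u, w) \<notin> E \<and> (w, u) \<notin> E})"
    by (intro acyclic_colourable_Un)
  then show ?thesis
    by (rule acyclic_colourable_mono) (use bag(1)[OF assms(3)] in \<open>auto simp: tri_def\<close>)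
qed

text \<open>Such an arc would make the bag \<open>B\<close> just above the zone of \<open>x\<close>
  too small. As \<open>y\<close> sends no arc into \<open>B\<close>, a vertex of \<open>B\<close> is
  an in-neighbour of \<open>x\<close>, a non-neighbour of \<open>x\<close> or \<open>y\<close>, or
  closes a triangle with the arc.\<close>

lemma no_arc_back_two_zones:
  assumes "x \<in> V" "y \<in> V" "zone Bs x + 2 \<le> zone Bs y"
  shows "(y, x) \<notin> E"
proof
  assume yx: "(y, x) \<in> E"
  define B where "B = Bs ! Suc (zone Bs x)"
  \<comment> \<open>Zones go up to \<open>length Bs\<close>, one beyond the last bag index; the gap
    of two guarantees that this bag exists.\<close>
  have l: "Suc (zone Bs x) < length Bs" using assms(3) zone_le[of Bs y] by simp
  have "col ((2 * c + N) + N + N + c) ({u \<in> B. (u, x) \<in> E} \<union> {u \<in> V. (u, x) \<notin> E \<and> (x, u) \<notin> E}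
      \<union> {u \<in> V. (u, y) \<notin> E \<and> (y, u) \<notin> E} \<union> tri y x)"
    unfolding B_def using assms(1,2) l yx
    by (intro acyclic_colourable_Un nonneighbours col_tri few_inneighbours_in_later_bag) auto
  moreover have "B \<subseteq> {u \<in> B. (u, x) \<in> E} \<union> {u \<in> V. (u, x) \<notin> E \<and> (x, u) \<notin> E}
      \<union> {u \<in> V. (u, y) \<notin> E \<and> (y, u) \<notin> E} \<union> tri y x"
    using bag(1)[OF l] no_arc_into_earlier_bag[of "Suc (zone Bs x)" Bs y] assms(3)
    by (auto simp: B_def tri_def)
  ultimately show False
    unfolding B_def by - (rule not_covered_bag[OF l], assumption+, simp)
qed

text \<open>The same covering, except that \<open>y\<close> may now send arcs into \<open>B\<close>,
  at the price of \<open>c\<close> more colours. The total is exactly the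
  \<open>4 * c + 3 * N\<close> of \<open>bag_bound\<close>.\<close>

lemma no_arc_from_later_bag:
  assumes "x \<in> V" "zone Bs x + 2 \<le> j" "j < length Bs" "y \<in> Bs ! j"
  shows "(y, x) \<notin> E"
proof
  assume yx: "(y, x) \<in> E"
  have yV: "y \<in> V" using assms bag(1) by blast
  define B where "B = Bs ! Suc (zone Bs x)"
  have l: "Suc (zone Bs x) < length Bs" using assms by simp
  have "before B (Bs ! j)" unfolding B_def using assms by (intro bag_before) auto
  then have "col c {u \<in> B. (y, u) \<in> E}" using assms(4) by (simp add: before_def)
  then have "col (c + (2 * c + N) + N + N + c) ({u \<in> B. (y, u) \<in> E} \<union> {u \<in> B. (u, x) \<in> E}
      \<union> {u \<in> V. (u, x) \<notin> E \<and> (x, u) \<notin> E} \<union> {u \<in> V. (u, y) \<notin> E \<and> (y, u) \<notin> E} \<union> tri y x)"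
    unfolding B_def using assms(1) yV l yx
    by (intro acyclic_colourable_Un nonneighbours col_tri few_inneighbours_in_later_bag) auto
  moreover have "B \<subseteq> {u \<in> B. (y, u) \<in> E} \<union> {u \<in> B. (u, x) \<in> E}
      \<union> {u \<in> V. (u, x) \<notin> E \<and> (x, u) \<notin> E} \<union> {u \<in> V. (u, y) \<notin> E \<and> (y, u) \<notin> E} \<union> tri y x"
    using bag(1)[OF l] by (auto simp: B_def tri_def)
  ultimately show False
    unfolding B_def by - (rule not_covered_bag[OF l], assumption+, simp)
qed

end

text \<open>Vertices of zone \<open>i\<close> send no arc to the bags before \<open>i\<close> and
  receive none from the bags from \<open>i + 2\<close> on. Only bags \<open>i\<close> and
  \<open>i + 1\<close> can conflict with new bags inside the zone.\<close>

lemma colourable_zone: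
  fixes i :: nat
  assumes "longest_chain Bs"
  defines "Z \<equiv> {v \<in> V. zone Bs v = i}"
  shows "col (2 * L (2 * L bag_bound + bag_bound)) Z"
proof (rule ccontr)
  assume *: "\<not> ?thesis"
  have ch: "chain Bs" using assms(1) by (simp add: longest_chain_def)
  have ZV: "Z \<subseteq> V" by (auto simp: Z_def)
  obtain A B C where ABC: "sorted_wrt before [A, B, C]"
      "\<And>X. X \<in> {A, B, C} \<Longrightarrow> X \<subseteq> Z" "\<And>X. X \<in> {A, B, C} \<Longrightarrow> \<not> col bag_bound X"
    using before_triple[OF ZV *] by blast
  have "Z \<noteq> {}" using * by auto
  then have il: "i \<le> length Bs" using zone_le by (auto simp: Z_def)
  txt \<open>The three new bags replace at most two old ones, contradicting maximality.\<close>
  define Cs where "Cs = take i Bs @ [A, B, C] @ drop (i + 2) Bs"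
  have 1: "before D X" if D: "D \<in> set (take i Bs)" and "X \<in> {A, B, C}" for D X
  proof -
    obtain j where "j < length (take i Bs)" "take i Bs ! j = D"
      using D by (meson in_set_conv_nth)
    then have j: "j < i" "D = Bs ! j" by auto
    show ?thesis
    proof (rule before_of_no_arcs)
      show "(x, d) \<notin> E" if "d \<in> D" "x \<in> X" for d x
        using that j ABC(2)[OF \<open>X \<in> _\<close>] no_arc_into_earlier_bag[of j Bs x d] by (auto simp: Z_def)
    qed
  qed
  have 2: "before X D" if D: "D \<in> set (drop (i + 2) Bs)" and "X \<in> {A, B, C}" for D X
  proof -
    obtain j' where "j' < length (drop (i + 2) Bs)" "drop (i + 2) Bs ! j' = D"
      using D by (meson in_set_conv_nth)
    then have j: "i + 2 \<le> i + 2 + j'" "i + 2 + j' < length Bs" "D = Bs ! (i + 2 + j')"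
      by (auto simp: add.commute)
    show ?thesis
    proof (rule before_of_no_arcs)
      show "(d, x) \<notin> E" if "x \<in> X" "d \<in> D" for x d
        using that j ABC(2)[OF \<open>X \<in> _\<close>] no_arc_from_later_bag[OF ch, of x "i + 2 + j'" d] by (auto simp: Z_def)
    qed
  qed
  have 3: "before D D'" if "D \<in> set (take i Bs)" "D' \<in> set (drop (i + 2) Bs)" for D D'
  proof -
    have "sorted_wrt before (take (i + 2) Bs @ drop (i + 2) Bs)"
      using ch by (simp only: append_take_drop_id) (simp add: chain_def)
    moreover have "D \<in> set (take (i + 2) Bs)"
      using that(1) set_take_subset_set_take[of i "i + 2" Bs] by auto
    ultimately show ?thesis using that(2) by (simp only: sorted_wrt_append)
  qed
  have "chain Cs"
    unfolding chain_def
  proof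
    show "sorted_wrt before Cs"
      using ch ABC(1) 1 2 3
      by (simp add: Cs_def sorted_wrt_append chain_def sorted_wrt_take sorted_wrt_drop)
    have "set Cs \<subseteq> set Bs \<union> {A, B, C}"
      unfolding Cs_def using set_take_subset[of i Bs] set_drop_subset[of "i + 2" Bs] by auto
    moreover have "X \<subseteq> V \<and> \<not> col bag_bound X" if "X \<in> set Bs" for X
      using ch that by (simp add: chain_def)
    moreover have "X \<subseteq> V \<and> \<not> col bag_bound X" if "X \<in> {A, B, C}" for X
      using ABC(2,3)[OF that] ZV by simp
    ultimately show "\<forall>B\<in>set Cs. B \<subseteq> V \<and> \<not> col bag_bound B"
      by (meson UnE subsetD)
  qed
  then have "length Cs \<le> length Bs" using assms(1) by (simp add: longest_chain_def)
  \<comment> \<open>Near the end of the list fewer than two bags are dropped, which only helps;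
    \<open>il\<close> ensures that \<open>take i Bs\<close> has length \<open>i\<close>.\<close>
  then show False using il by (simp add: Cs_def)
qed

text \<open>Zones of equal parity differ by at least two unless they are equal, so arcs among them
  never go back and \<open>acyclic_colourable_layers\<close> applies. The two parities give the
  outer factor \<open>2\<close>.\<close>

lemma colourable_V: "col (2 * (2 * L (2 * L bag_bound + bag_bound))) V"
proof -
  define m where "m = 2 * L (2 * L bag_bound + bag_bound)"
  obtain Bs where Bs: "longest_chain Bs" using ex_longest_chain by blast
  then have ch: "chain Bs" by (simp add: longest_chain_def)
  have "col m {v \<in> V. even (zone Bs v) = b}" (is "col m ?S") for b
  proof (rule acyclic_colourable_layers)
    show "col m {v \<in> ?S. zone Bs v = i}" for i
      using colourable_zone[OF Bs, of i] unfolding m_def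
      by (rule acyclic_colourable_mono) auto
    show "zone Bs u \<le> zone Bs v" if "u \<in> ?S" "v \<in> ?S" "(u, v) \<in> E" for u v
    proof (rule ccontr)
      assume *: "\<not> zone Bs u \<le> zone Bs v"
      moreover have "zone Bs u \<noteq> Suc (zone Bs v)" using that by auto
      ultimately show False using no_arc_back_two_zones[OF ch, of v u] that by auto
    qed
  qed
  then have "col (m + m) ({v \<in> V. even (zone Bs v) = True} \<union> {v \<in> V. even (zone Bs v) = False})"
    by (intro acyclic_colourable_Un)
  then show ?thesis
    by (rule acyclic_colourable_mono) (auto simp: m_def)
qed

end


section \<open>Induced subdigraphs and heroes\<close>

text \<open>
  Stating containment for an arc relation and a vertex set, rather than for a digraph, avoids
  forming induced subdigraphs: only arcs inside \<open>S\<close> matter.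
\<close>

definition contains :: "'v rel \<Rightarrow> 'v set \<Rightarrow> 'a pair_pre_digraph \<Rightarrow> bool" where
  "contains E S F \<longleftrightarrow> (\<exists>f. inj_on f (pverts F) \<and> f ` pverts F \<subseteq> S \<and>
     (\<forall>u\<in>pverts F. \<forall>v\<in>pverts F. (u, v) \<in> parcs F \<longleftrightarrow> (f u, f v) \<in> E))"

lemma contains_mono: "contains E S F \<Longrightarrow> S \<subseteq> T \<Longrightarrow> contains E T F"
  unfolding contains_def by blast

lemma contains_Restr: "contains (Restr E S) S F = contains E S F"
  unfolding contains_def by (intro ex_cong1 conj_cong refl ball_cong) blast

lemma contains_bounded_subset:
  assumes "contains E S F" "finite (pverts F)"
  shows "\<exists>X\<subseteq>S. card X \<le> card (pverts F) \<and> contains E X F"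
proof -
  obtain f where f: "inj_on f (pverts F)" "f ` pverts F \<subseteq> S"
    "\<forall>u\<in>pverts F. \<forall>v\<in>pverts F. (u, v) \<in> parcs F \<longleftrightarrow> (f u, f v) \<in> E"
    using assms(1) by (auto simp: contains_def)
  then have "contains E (f ` pverts F) F" unfolding contains_def by blast
  then show ?thesis using f(2) card_image_le[OF assms(2)] by blast
qed

lemma free_of_iff:
  fixes D :: "'v pair_pre_digraph" and F :: "'a pair_pre_digraph"
  assumes "pair_wf_digraph D" "pair_wf_digraph F"
  shows "free_of D F \<longleftrightarrow> \<not> contains (parcs D) (pverts D) F"
proof -
  have "(\<exists>D'. induced_subgraph D' (with_proj D) \<and> digraph_iso D' (with_proj F)) \<longleftrightarrow>
      contains (parcs D) (pverts D) F"
  proof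
    assume "\<exists>D'. induced_subgraph D' (with_proj D) \<and> digraph_iso D' (with_proj F)"
    then obtain D' h where D': "induced_subgraph D' (with_proj D)"
      and h: "pre_digraph.digraph_isomorphism D' h" and F: "with_proj F = app_iso h D'"
      unfolding digraph_iso_def by blast
    have V: "verts D' \<subseteq> pverts D" and A: "arcs D' = Restr (parcs D) (verts D')"
      and tl: "tail D' = fst" and hd: "head D' = snd"
      using D' by (auto simp: induced_subgraph_def subgraph_def compatible_def)
    have FV: "pverts F = iso_verts h ` verts D'" and FA: "parcs F = iso_arcs h ` arcs D'"
      and ft: "iso_tail h = fst" and fh: "iso_head h = snd"
      using F by (simp_all add: with_proj_def app_iso_def)
    have inj: "inj_on (iso_verts h) (verts D')"
      using h by (simp add: pre_digraph.digraph_isomorphism_def)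
    \<comment> \<open>An isomorphism carries its arc map as separate data; compatibility with tails
      and heads, which are the projections on both sides, determines it.\<close>
    have arc: "iso_arcs h (x, y) = (iso_verts h x, iso_verts h y)" if "(x, y) \<in> arcs D'" for x y
    proof (rule prod_eqI)
      show "fst (iso_arcs h (x, y)) = fst (iso_verts h x, iso_verts h y)"
        and "snd (iso_arcs h (x, y)) = snd (iso_verts h x, iso_verts h y)"
        using h that by (force simp: pre_digraph.digraph_isomorphism_def tl hd ft fh)+
    qed
    define f where "f = the_inv_into (verts D') (iso_verts h)"
    have f: "f (iso_verts h x) = x" if "x \<in> verts D'" for x
      using the_inv_into_f_f[OF inj that] by (simp add: f_def)
    have "(iso_verts h x, iso_verts h y) \<in> parcs F \<longleftrightarrow> (x, y) \<in> parcs D"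
      if "x \<in> verts D'" "y \<in> verts D'" for x y
    proof
      assume "(iso_verts h x, iso_verts h y) \<in> parcs F"
      then obtain a b where ab: "(a, b) \<in> arcs D'" "iso_arcs h (a, b) = (iso_verts h x, iso_verts h y)"
        by (auto simp: FA)
      then have "iso_verts h a = iso_verts h x" "iso_verts h b = iso_verts h y" using arc by auto
      moreover have "a \<in> verts D'" "b \<in> verts D'" using ab(1) A by auto
      ultimately have "a = x" "b = y" using inj that by (auto simp: inj_on_def)
      then show "(x, y) \<in> parcs D" using ab(1) A by auto
    next
      assume "(x, y) \<in> parcs D"
      then have "(x, y) \<in> arcs D'" using that A by auto
      then show "(iso_verts h x, iso_verts h y) \<in> parcs F" using arc FA by (metis imageI)
    qed
    then have "\<forall>u\<in>pverts F. \<forall>v\<in>pverts F. (u, v) \<in> parcs F \<longleftrightarrow> (f u, f v) \<in> parcs D"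
      by (auto simp: FV f)
    moreover have "inj_on f (pverts F)" by (auto simp: FV f inj_on_def)
    moreover have "f ` pverts F \<subseteq> pverts D" using V by (auto simp: FV f)
    ultimately show "contains (parcs D) (pverts D) F" unfolding contains_def by blast
  next
    assume "contains (parcs D) (pverts D) F"
    then obtain f where f: "inj_on f (pverts F)" "f ` pverts F \<subseteq> pverts D"
      "\<And>u v. u \<in> pverts F \<Longrightarrow> v \<in> pverts F \<Longrightarrow> (u, v) \<in> parcs F \<longleftrightarrow> (f u, f v) \<in> parcs D"
      by (auto simp: contains_def)
    interpret D: pair_wf_digraph D by fact
    interpret F: pair_wf_digraph F by fact
    define D' where "D' = with_proj D \<restriction> (f ` pverts F)"
    define g where "g = the_inv_into (pverts F) f"
    have g: "g (f x) = x" if "x \<in> pverts F" for x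
      using the_inv_into_f_f[OF f(1) that] by (simp add: g_def)
    have D'V: "verts D' = f ` pverts F" and D'A: "arcs D' = Restr (parcs D) (f ` pverts F)"
      and tl: "tail D' = fst" and hd: "head D' = snd"
      by (auto simp: D'_def induce_subgraph_def)
    have wf: "wf_digraph D'" by unfold_locales (auto simp: D'V D'A tl hd)
    have "induced_subgraph D' (with_proj D)"
      unfolding induced_subgraph_def subgraph_def compatible_def
      using f(2) wf D.wf_digraph by (auto simp: D'V D'A tl hd)
    \<comment> \<open>The isomorphism leads from the induced copy to \<open>F\<close>, hence the
      inverse \<open>g\<close> of the embedding.\<close>
    define h where "h = \<lparr> iso_verts = g, iso_arcs = map_prod g g, iso_head = snd, iso_tail = fst \<rparr>"
    have A: "arcs D' = map_prod f f ` parcs F"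
    proof (intro equalityI subsetI)
      fix e assume "e \<in> arcs D'"
      then obtain u v where "u \<in> pverts F" "v \<in> pverts F" "e = (f u, f v)" "e \<in> parcs D"
        by (auto simp: D'A)
      then show "e \<in> map_prod f f ` parcs F" using f(3)[of u v] by force
    next
      fix e assume "e \<in> map_prod f f ` parcs F"
      then obtain u v where uv: "(u, v) \<in> parcs F" "e = (f u, f v)" by auto
      then have "u \<in> pverts F" "v \<in> pverts F" using F.wellformed' by blast+
      then show "e \<in> arcs D'" using uv f(3) by (auto simp: D'A)
    qed
    have gA: "map_prod g g (map_prod f f e) = e" if "e \<in> parcs F" for e
      using that F.wellformed' by (cases e) (auto simp: g)
    have "pre_digraph.digraph_isomorphism D' h"
      unfolding pre_digraph.digraph_isomorphism_def
      using wf by (auto simp: h_def D'V A tl hd g gA inj_on_def dest: F.wellformed')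
    moreover have "with_proj F = app_iso h D'"
    proof -
      have "g ` f ` pverts F = pverts F" by (auto simp: g image_image)
      moreover have "map_prod g g ` map_prod f f ` parcs F = parcs F"
        unfolding image_image using gA by auto
      ultimately show ?thesis by (simp add: with_proj_def app_iso_def h_def D'V A)
    qed
    ultimately show "\<exists>D'. induced_subgraph D' (with_proj D) \<and> digraph_iso D' (with_proj F)"
      using \<open>induced_subgraph D' _\<close> unfolding digraph_iso_def by blast
  qed
  then show ?thesis by (simp add: free_of_def)
qed

section \<open>Well-formedness and colour bounds for digraph records\<close>

lemma pair_wf_digraphI: "parcs D \<subseteq> pverts D \<times> pverts D \<Longrightarrow> pair_wf_digraph D"
  by unfold_locales auto

lemma pair_wf_digraphD: "pair_wf_digraph D \<Longrightarrow> parcs D \<subseteq> pverts D \<times> pverts D"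
  by (auto simp: pair_wf_digraph_def)

lemma oriented_digraph_wf: "oriented_digraph D \<Longrightarrow> pair_wf_digraph D"
  by (simp add: oriented_digraph_def pair_digraph_def pair_fin_digraph_def)

lemma oriented_digraph_iff:
  "oriented_digraph D \<longleftrightarrow> finite (pverts D) \<and> parcs D \<subseteq> pverts D \<times> pverts D \<and> asym (parcs D)"
proof
  assume "oriented_digraph D"
  then interpret oriented_digraph D .
  show "finite (pverts D) \<and> parcs D \<subseteq> pverts D \<times> pverts D \<and> asym (parcs D)"
    using pair_finite_verts pair_wf_digraphD[OF pair_wf_digraph] no_digons by (auto simp: asym_iff)
next
  assume *: "finite (pverts D) \<and> parcs D \<subseteq> pverts D \<times> pverts D \<and> asym (parcs D)"
  then have "finite (parcs D)" by (meson finite_SigmaI finite_subset)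
  then show "oriented_digraph D"
    using * by unfold_locales (auto simp: asym_iff, blast)
qed

lemma wf_K1: "pair_wf_digraph K1"
  by (rule pair_wf_digraphI) (simp add: K1_def)

lemma wf_disj_union: "pair_wf_digraph D1 \<Longrightarrow> pair_wf_digraph D2 \<Longrightarrow> pair_wf_digraph (D1 \<oplus>\<^sub>D D2)"
  by (rule pair_wf_digraphI) (auto simp: disj_union_def dest!: pair_wf_digraphD)

lemma wf_copies: "pair_wf_digraph D \<Longrightarrow> pair_wf_digraph (copies r D)"
  by (rule pair_wf_digraphI) (auto simp: copies_def dest!: pair_wf_digraphD)

lemma wf_dijoin: "pair_wf_digraph D1 \<Longrightarrow> pair_wf_digraph D2 \<Longrightarrow> pair_wf_digraph (D1 \<Rightarrow>\<^sub>D D2)"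
  by (rule pair_wf_digraphI) (auto simp: dijoin_def disj_union_def dest!: pair_wf_digraphD)

lemma wf_Delta:
  "pair_wf_digraph D1 \<Longrightarrow> pair_wf_digraph D2 \<Longrightarrow> pair_wf_digraph D3 \<Longrightarrow> pair_wf_digraph (Delta D1 D2 D3)"
  by (rule pair_wf_digraphI) (auto simp: Delta_def Let_def disj_union_def dest!: pair_wf_digraphD)

lemma dichromatic_number_with_proj_le_iff:
  assumes "oriented_digraph D"
  shows "dichromatic_number (with_proj D) \<le> k \<longleftrightarrow> acyclic_colourable (parcs D) k (pverts D)"
  using dichromatic_number_le_iff[of "with_proj D" k] assms
  by (auto simp: oriented_digraph_iff asym_iff)

lemma dichromatic_number_induced_le_iff:
  assumes "oriented_digraph D" "finite S"
  shows "dichromatic_number (with_proj D \<restriction> S) \<le> k \<longleftrightarrow> acyclic_colourable (parcs D) k S"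
  using dichromatic_number_le_iff[of "with_proj D \<restriction> S" k] assms
  by (auto simp: oriented_digraph_iff asym_iff arcs_ends_induce_subgraph acyclic_colourable_Restr)

section \<open>Heroes as uniform bounds over relations and vertex sets\<close>

definition digraph_on :: "'v rel \<Rightarrow> 'v set \<Rightarrow> 'v pair_pre_digraph" where
  "digraph_on E V = \<lparr> pverts = V, parcs = Restr E V \<rparr>"

lemma oriented_digraph_on: "finite V \<Longrightarrow> asym E \<Longrightarrow> oriented_digraph (digraph_on E V)"
  by (auto simp: oriented_digraph_iff digraph_on_def asym_iff)

text \<open>\<open>P\<close> stands for an extra condition such as being \<open>k\<close>-local, and
  \<open>Q\<close> for its relational form. Invariance of \<open>Q\<close> under restriction lets an
  arbitrary relation be cut down to the arcs a digraph on \<open>V\<close> may have.\<close>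

lemma hero_in_iff:
  fixes H :: "'h pair_pre_digraph" and F :: "'f pair_pre_digraph"
  assumes "pair_wf_digraph H" "pair_wf_digraph F"
    and P: "\<And>D. oriented_digraph D \<Longrightarrow> P D \<longleftrightarrow> Q (parcs D) (pverts D)"
    and Q: "\<And>E V. Q (Restr E V) V \<longleftrightarrow> Q E V"
  shows "hero_in H {D \<in> free_class F. P D} \<longleftrightarrow>
    (\<exists>c. \<forall>(E :: nat rel) V. finite V \<longrightarrow> asym E \<longrightarrow> Q E V \<longrightarrow> \<not> contains E V F \<longrightarrow> \<not> contains E V H \<longrightarrow>
       acyclic_colourable E c V)"
proof -
  have "(\<forall>D\<in>{D \<in> free_class F. P D}. free_of D H \<longrightarrow> dichromatic_number (with_proj D) \<le> c) \<longleftrightarrow>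
    (\<forall>(E :: nat rel) V. finite V \<longrightarrow> asym E \<longrightarrow> Q E V \<longrightarrow> \<not> contains E V F \<longrightarrow> \<not> contains E V H \<longrightarrow>
       acyclic_colourable E c V)" (is "?L \<longleftrightarrow> ?R") for c
  proof
    assume L: ?L
    show ?R
    proof (intro allI impI)
      fix E :: "nat rel" and V
      assume *: "finite V" "asym E" "Q E V" "\<not> contains E V F" "\<not> contains E V H"
      define D where "D = digraph_on E V"
      have D: "oriented_digraph D" unfolding D_def using *(1,2) by (rule oriented_digraph_on)
      have "D \<in> free_class F" "P D" "free_of D H"
        using * D assms(1,2) P[OF D] Q
        by (simp_all add: free_class_def free_of_iff oriented_digraph_wf D_def digraph_on_def contains_Restr)
      then have "dichromatic_number (with_proj D) \<le> c" using L by blast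
      then show "acyclic_colourable E c V"
        by (simp add: dichromatic_number_with_proj_le_iff[OF D])
          (simp add: D_def digraph_on_def acyclic_colourable_Restr)
    qed
  next
    assume R: ?R
    show ?L
    proof (intro ballI impI)
      fix D assume D: "D \<in> {D \<in> free_class F. P D}" "free_of D H"
      then have o: "oriented_digraph D" by (simp add: free_class_def)
      have "acyclic_colourable (parcs D) c (pverts D)"
        using R D o P[OF o] assms(1,2)
        by (auto simp: free_class_def free_of_iff oriented_digraph_wf oriented_digraph_iff)
      then show "dichromatic_number (with_proj D) \<le> c"
        by (simp add: dichromatic_number_with_proj_le_iff[OF o])
    qed
  qed
  then show ?thesis by (simp add: hero_in_def)
qed

lemma hero_in_free_class_iff:
  assumes "pair_wf_digraph H" "pair_wf_digraph F"
  shows "hero_in H (free_class F) \<longleftrightarrow>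
    (\<exists>c. \<forall>(E :: nat rel) V. finite V \<longrightarrow> asym E \<longrightarrow> \<not> contains E V F \<longrightarrow> \<not> contains E V H \<longrightarrow>
       acyclic_colourable E c V)"
  using hero_in_iff[OF assms, of "\<lambda>_. True" "\<lambda>_ _. True"] by simp

lemma hero_in_free_classE:
  assumes "hero_in H (free_class F)" "pair_wf_digraph H" "pair_wf_digraph F"
  obtains c where "\<And>(E :: nat rel) V. finite V \<Longrightarrow> asym E \<Longrightarrow> \<not> contains E V F \<Longrightarrow>
    \<not> contains E V H \<Longrightarrow> acyclic_colourable E c V"
  using assms(1) unfolding hero_in_free_class_iff[OF assms(2,3)] by blast

lemma hero_in_k_local_iff:
  assumes "pair_wf_digraph H" "pair_wf_digraph F"
  shows "hero_in H {D \<in> free_class F. k_local k D} \<longleftrightarrow>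
    (\<exists>c. \<forall>(E :: nat rel) V. finite V \<longrightarrow> asym E \<longrightarrow>
       (\<forall>v\<in>V. acyclic_colourable E k {u \<in> V. (v, u) \<in> E}) \<longrightarrow>
       \<not> contains E V F \<longrightarrow> \<not> contains E V H \<longrightarrow> acyclic_colourable E c V)"
proof (rule hero_in_iff[OF assms])
  fix D :: "nat pair_pre_digraph" assume D: "oriented_digraph D"
  have "{u. (v, u) \<in> parcs D} = {u \<in> pverts D. (v, u) \<in> parcs D}" for v
    using D by (auto simp: oriented_digraph_iff)
  moreover have "finite {u \<in> pverts D. (v, u) \<in> parcs D}" for v
    using D by (simp add: oriented_digraph_iff)
  ultimately show "k_local k D \<longleftrightarrow>
      (\<forall>v\<in>pverts D. acyclic_colourable (parcs D) k {u \<in> pverts D. (v, u) \<in> parcs D})"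
    by (simp add: k_local_def dichromatic_number_induced_le_iff[OF D])
next
  fix E :: "nat rel" and V
  have "acyclic_colourable (Restr E V) k {u \<in> V. (v, u) \<in> Restr E V} \<longleftrightarrow>
      acyclic_colourable E k {u \<in> V. (v, u) \<in> E}" if "v \<in> V" for v
  proof -
    have eq: "{u \<in> V. (v, u) \<in> Restr E V} = {u \<in> V. (v, u) \<in> E}" (is "_ = ?S") using that by auto
    have "Restr (Restr E V) ?S = Restr E ?S" by auto
    then show ?thesis 
      unfolding eq using acyclic_colourable_Restr[of "Restr E V" ?S k] acyclic_colourable_Restr[of E ?S k]
      by (simp only:)
  qed
  then show "(\<forall>v\<in>V. acyclic_colourable (Restr E V) k {u \<in> V. (v, u) \<in> Restr E V}) \<longleftrightarrow>
      (\<forall>v\<in>V. acyclic_colourable E k {u \<in> V. (v, u) \<in> E})" by blast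
qed

lemma hero_in_k_colocal_iff:
  assumes "pair_wf_digraph H" "pair_wf_digraph F"
  shows "hero_in H {D \<in> free_class F. k_colocal k D} \<longleftrightarrow>
    (\<exists>c. \<forall>(E :: nat rel) V. finite V \<longrightarrow> asym E \<longrightarrow>
       (\<forall>v\<in>V. acyclic_colourable E k {u \<in> V. (u, v) \<in> E}) \<longrightarrow>
       \<not> contains E V F \<longrightarrow> \<not> contains E V H \<longrightarrow> acyclic_colourable E c V)"
proof (rule hero_in_iff[OF assms])
  fix D :: "nat pair_pre_digraph" assume D: "oriented_digraph D"
  have "{u. (u, v) \<in> parcs D} = {u \<in> pverts D. (u, v) \<in> parcs D}" for v
    using D by (auto simp: oriented_digraph_iff)
  moreover have "finite {u \<in> pverts D. (u, v) \<in> parcs D}" for v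
    using D by (simp add: oriented_digraph_iff)
  ultimately show "k_colocal k D \<longleftrightarrow>
      (\<forall>v\<in>pverts D. acyclic_colourable (parcs D) k {u \<in> pverts D. (u, v) \<in> parcs D})"
    by (simp add: k_colocal_def dichromatic_number_induced_le_iff[OF D])
next
  fix E :: "nat rel" and V
  have "acyclic_colourable (Restr E V) k {u \<in> V. (u, v) \<in> Restr E V} \<longleftrightarrow>
      acyclic_colourable E k {u \<in> V. (u, v) \<in> E}" if "v \<in> V" for v
  proof -
    have eq: "{u \<in> V. (u, v) \<in> Restr E V} = {u \<in> V. (u, v) \<in> E}" (is "_ = ?S") using that by auto
    have "Restr (Restr E V) ?S = Restr E ?S" by auto
    then show ?thesis 
      unfolding eq using acyclic_colourable_Restr[of "Restr E V" ?S k] acyclic_colourable_Restr[of E ?S k]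
      by (simp only:)
  qed
  then show "(\<forall>v\<in>V. acyclic_colourable (Restr E V) k {u \<in> V. (u, v) \<in> Restr E V}) \<longleftrightarrow>
      (\<forall>v\<in>V. acyclic_colourable E k {u \<in> V. (u, v) \<in> E})" by blast
qed

section \<open>Embedding joins, triangles and added isolated vertices\<close>

lemma pverts_dijoin: "pverts (D1 \<Rightarrow>\<^sub>D D2) = Inl ` pverts D1 \<union> Inr ` pverts D2"
  by (auto simp: dijoin_def disj_union_def)

lemma parcs_dijoin:
  "(Inl a, Inl a') \<in> parcs (D1 \<Rightarrow>\<^sub>D D2) \<longleftrightarrow> (a, a') \<in> parcs D1"
  "(Inr b, Inr b') \<in> parcs (D1 \<Rightarrow>\<^sub>D D2) \<longleftrightarrow> (b, b') \<in> parcs D2"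
  "(Inl a, Inr b) \<in> parcs (D1 \<Rightarrow>\<^sub>D D2) \<longleftrightarrow> a \<in> pverts D1 \<and> b \<in> pverts D2"
  "(Inr b, Inl a) \<notin> parcs (D1 \<Rightarrow>\<^sub>D D2)"
  by (auto simp: dijoin_def disj_union_def)

lemma pverts_Delta_K1: "pverts (Delta K1 K1 D) = {Inl (), Inr (Inl ())} \<union> (\<lambda>x. Inr (Inr x)) ` pverts D"
  by (auto simp: Delta_def Let_def disj_union_def K1_def)

lemma parcs_Delta_K1:
  "(Inl x, Inl x) \<notin> parcs (Delta K1 K1 D)"
  "(Inl x, Inr (Inl y)) \<in> parcs (Delta K1 K1 D)"
  "(Inr (Inl y), Inl x) \<notin> parcs (Delta K1 K1 D)"
  "(Inr (Inl y), Inr (Inl y)) \<notin> parcs (Delta K1 K1 D)"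
  "(Inl x, Inr (Inr z)) \<notin> parcs (Delta K1 K1 D)"
  "(Inr (Inr z), Inl x) \<in> parcs (Delta K1 K1 D) \<longleftrightarrow> z \<in> pverts D"
  "(Inr (Inl y), Inr (Inr z)) \<in> parcs (Delta K1 K1 D) \<longleftrightarrow> z \<in> pverts D"
  "(Inr (Inr z), Inr (Inl y)) \<notin> parcs (Delta K1 K1 D)"
  "(Inr (Inr z), Inr (Inr z')) \<in> parcs (Delta K1 K1 D) \<longleftrightarrow> (z, z') \<in> parcs D"
  by (auto simp: Delta_def Let_def disj_union_def K1_def image_iff intro!: bexI[rotated])

lemma contains_dijoin:
  assumes "contains E A H1" "contains E B H2" "A \<times> B \<subseteq> E" "asym E"
  shows "contains E (A \<union> B) (H1 \<Rightarrow>\<^sub>D H2)"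
proof -
  obtain f where f: "inj_on f (pverts H1)" "\<And>x. x \<in> pverts H1 \<Longrightarrow> f x \<in> A"
    "\<And>u v. u \<in> pverts H1 \<Longrightarrow> v \<in> pverts H1 \<Longrightarrow> (u, v) \<in> parcs H1 \<longleftrightarrow> (f u, f v) \<in> E"
    using assms(1) by (auto simp: contains_def)
  obtain g where g: "inj_on g (pverts H2)" "\<And>x. x \<in> pverts H2 \<Longrightarrow> g x \<in> B"
    "\<And>u v. u \<in> pverts H2 \<Longrightarrow> v \<in> pverts H2 \<Longrightarrow> (u, v) \<in> parcs H2 \<longleftrightarrow> (g u, g v) \<in> E"
    using assms(2) by (auto simp: contains_def)
  have fg: "(f x, g y) \<in> E" "(g y, f x) \<notin> E" "f x \<noteq> g y" "g y \<noteq> f x"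
    if "x \<in> pverts H1" "y \<in> pverts H2" for x y
  proof -
    show "(f x, g y) \<in> E" using that f(2) g(2) assms(3) by auto
    then show "(g y, f x) \<notin> E" "f x \<noteq> g y" "g y \<noteq> f x" using asymD[OF assms(4)] by metis+
  qed
  show ?thesis
    unfolding contains_def
  proof (intro exI conjI)
    show "inj_on (case_sum f g) (pverts (H1 \<Rightarrow>\<^sub>D H2))"
      using f(1) g(1) fg(3,4) by (simp add: pverts_dijoin inj_on_def ball_Un)
    show "case_sum f g ` pverts (H1 \<Rightarrow>\<^sub>D H2) \<subseteq> A \<union> B"
      using f(2) g(2) by (auto simp: pverts_dijoin image_Un image_image)
    show "\<forall>u\<in>pverts (H1 \<Rightarrow>\<^sub>D H2). \<forall>v\<in>pverts (H1 \<Rightarrow>\<^sub>D H2).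
        (u, v) \<in> parcs (H1 \<Rightarrow>\<^sub>D H2) \<longleftrightarrow> (case_sum f g u, case_sum f g v) \<in> E"
      using f(3) g(3) fg(1,2) by (simp add: pverts_dijoin parcs_dijoin ball_Un)
  qed
qed

lemma contains_Delta:
  assumes "(u, v) \<in> E" "contains E W H" "{v} \<times> W \<subseteq> E" "W \<times> {u} \<subseteq> E" "asym E"
  shows "contains E ({u, v} \<union> W) (Delta K1 K1 H)"
proof -
  obtain f where f: "inj_on f (pverts H)" "\<And>x. x \<in> pverts H \<Longrightarrow> f x \<in> W"
    "\<And>u v. u \<in> pverts H \<Longrightarrow> v \<in> pverts H \<Longrightarrow> (u, v) \<in> parcs H \<longleftrightarrow> (f u, f v) \<in> E"
    using assms(2) by (auto simp: contains_def)
  define g where "g = case_sum (\<lambda>_ :: unit. u) (case_sum (\<lambda>_ :: unit. v) f)"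
  have loop: "(x, x) \<notin> E" for x using asymD[OF assms(5)] by blast
  have uv: "(v, u) \<notin> E" "u \<noteq> v" "v \<noteq> u" using asymD[OF assms(5)] assms(1) by blast+
  have fE: "(v, f x) \<in> E" "(f x, v) \<notin> E" "f x \<noteq> v" "v \<noteq> f x"
      "(f x, u) \<in> E" "(u, f x) \<notin> E" "f x \<noteq> u" "u \<noteq> f x" if "x \<in> pverts H" for x
  proof -
    show "(v, f x) \<in> E" "(f x, u) \<in> E" using that f(2) assms(3,4) by auto
    then show "(f x, v) \<notin> E" "f x \<noteq> v" "v \<noteq> f x" "(u, f x) \<notin> E" "f x \<noteq> u" "u \<noteq> f x"
      using asymD[OF assms(5)] by metis+
  qed
  show ?thesis
    unfolding contains_def
  proof (intro exI conjI)
    show "inj_on g (pverts (Delta K1 K1 H))"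
      using f(1) uv fE by (auto simp: g_def pverts_Delta_K1 inj_on_def)
    show "g ` pverts (Delta K1 K1 H) \<subseteq> {u, v} \<union> W"
      using f(2) by (auto simp: g_def pverts_Delta_K1)
    show "\<forall>x\<in>pverts (Delta K1 K1 H). \<forall>y\<in>pverts (Delta K1 K1 H).
        (x, y) \<in> parcs (Delta K1 K1 H) \<longleftrightarrow> (g x, g y) \<in> E"
      using f(3) uv fE loop assms(1)
      by (auto simp: g_def pverts_Delta_K1 parcs_Delta_K1)
  qed
qed

lemma contains_add_isolated:
  assumes "contains E W (copies r K1 \<oplus>\<^sub>D F)" "v \<notin> W" "asym E"
    and "\<And>w. w \<in> W \<Longrightarrow> (v, w) \<notin> E \<and> (w, v) \<notin> E"
  shows "contains E (insert v W) (copies (Suc r) K1 \<oplus>\<^sub>D F)"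
proof -
  define G where "G = copies r K1 \<oplus>\<^sub>D F"
  define G' where "G' = copies (Suc r) K1 \<oplus>\<^sub>D F"
  \<comment> \<open>Index \<open>r\<close> belongs to the one isolated vertex that
    \<open>copies (Suc r) K1\<close> has in addition; it is sent to \<open>v\<close>.\<close>
  define n :: "nat \<times> unit + 'b" where "n = Inl (r, ())"
  have V: "pverts G' = insert n (pverts G)" "n \<notin> pverts G"
    by (auto simp: G_def G'_def n_def disj_union_def copies_def K1_def less_Suc_eq)
  have A: "parcs G' = parcs G" by (auto simp: G_def G'_def disj_union_def copies_def K1_def)
  have nA: "(n, x) \<notin> parcs G" "(x, n) \<notin> parcs G" for x
    by (auto simp: G_def n_def disj_union_def copies_def K1_def)
  obtain f where f: "inj_on f (pverts G)" "\<And>x. x \<in> pverts G \<Longrightarrow> f x \<in> W"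
    "\<And>u v. u \<in> pverts G \<Longrightarrow> v \<in> pverts G \<Longrightarrow> (u, v) \<in> parcs G \<longleftrightarrow> (f u, f v) \<in> E"
    using assms(1) by (auto simp: contains_def G_def)
  have loop: "(v, v) \<notin> E" using asymD[OF assms(3)] by blast
  have fv: "f x \<noteq> v" "v \<noteq> f x" "(f x, v) \<notin> E" "(v, f x) \<notin> E" if "x \<in> pverts G" for x
    using f(2)[OF that] assms(2,4) by auto
  have ne: "x \<noteq> n" if "x \<in> pverts G" for x using that V(2) by auto
  show ?thesis
    unfolding contains_def G'_def[symmetric]
  proof (intro exI conjI)
    show "inj_on (f(n := v)) (pverts G')" using f(1) fv ne by (auto simp: V inj_on_def)
    show "(f(n := v)) ` pverts G' \<subseteq> insert v W" using f(2) ne by (auto simp: V)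
    show "\<forall>x\<in>pverts G'. \<forall>y\<in>pverts G'. (x, y) \<in> parcs G' \<longleftrightarrow> ((f(n := v)) x, (f(n := v)) y) \<in> E"
      using f(3) fv ne loop nA by (auto simp: V A)
  qed
qed

lemma contains_copies_Suc:
  assumes "contains E V (copies (Suc r) K1 \<oplus>\<^sub>D F)"
  shows "contains E V (copies r K1 \<oplus>\<^sub>D F)"
proof -
  have "pverts (copies r K1 \<oplus>\<^sub>D F) \<subseteq> pverts (copies (Suc r) K1 \<oplus>\<^sub>D F)"
    "parcs (copies r K1 \<oplus>\<^sub>D F) = parcs (copies (Suc r) K1 \<oplus>\<^sub>D F)"
    by (auto simp: disj_union_def copies_def K1_def)
  note sub = this
  obtain f where f: "inj_on f (pverts (copies (Suc r) K1 \<oplus>\<^sub>D F))"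
    "f ` pverts (copies (Suc r) K1 \<oplus>\<^sub>D F) \<subseteq> V"
    "\<forall>u\<in>pverts (copies (Suc r) K1 \<oplus>\<^sub>D F). \<forall>v\<in>pverts (copies (Suc r) K1 \<oplus>\<^sub>D F).
      (u, v) \<in> parcs (copies (Suc r) K1 \<oplus>\<^sub>D F) \<longleftrightarrow> (f u, f v) \<in> E"
    using assms unfolding contains_def by blast
  show ?thesis
    unfolding contains_def
  proof (intro exI conjI)
    show "inj_on f (pverts (copies r K1 \<oplus>\<^sub>D F))" using f(1) sub(1) by (rule inj_on_subset)
    show "f ` pverts (copies r K1 \<oplus>\<^sub>D F) \<subseteq> V" using f(2) sub(1) by blast
    show "\<forall>u\<in>pverts (copies r K1 \<oplus>\<^sub>D F). \<forall>v\<in>pverts (copies r K1 \<oplus>\<^sub>D F).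
        (u, v) \<in> parcs (copies r K1 \<oplus>\<^sub>D F) \<longleftrightarrow> (f u, f v) \<in> E"
      unfolding sub(2) using f(3) sub(1) by blast
  qed
qed

lemma contains_copies_0: "contains E V (copies 0 K1 \<oplus>\<^sub>D F) \<longleftrightarrow> contains E V F"
proof -
  have V: "pverts (copies 0 K1 \<oplus>\<^sub>D F) = Inr ` pverts F"
    and A: "parcs (copies 0 K1 \<oplus>\<^sub>D F) = map_prod Inr Inr ` parcs F"
    by (auto simp: disj_union_def copies_def K1_def)
  have A': "(Inr x, Inr y) \<in> parcs (copies 0 K1 \<oplus>\<^sub>D F) \<longleftrightarrow> (x, y) \<in> parcs F" for x y
    by (auto simp: A)
  show ?thesis
  proof
    assume "contains E V (copies 0 K1 \<oplus>\<^sub>D F)"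
    then obtain f where "inj_on f (Inr ` pverts F)" "f ` Inr ` pverts F \<subseteq> V"
      "\<forall>u\<in>Inr ` pverts F. \<forall>v\<in>Inr ` pverts F. (u, v) \<in> parcs (copies 0 K1 \<oplus>\<^sub>D F) \<longleftrightarrow> (f u, f v) \<in> E"
      unfolding contains_def V by blast
    then show "contains E V F"
      unfolding contains_def by (intro exI[of _ "f \<circ> Inr"]) (auto simp: inj_on_def A')
  next
    assume "contains E V F"
    then obtain f where "inj_on f (pverts F)" "f ` pverts F \<subseteq> V"
      "\<forall>u\<in>pverts F. \<forall>v\<in>pverts F. (u, v) \<in> parcs F \<longleftrightarrow> (f u, f v) \<in> E"
      unfolding contains_def by blast
    then show "contains E V (copies 0 K1 \<oplus>\<^sub>D F)"
      unfolding contains_def by (intro exI[of _ "f \<circ> projr"]) (auto simp: inj_on_def V A')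
  qed
qed

section \<open>From \<open>r\<close> to \<open>r + 1\<close> isolated vertices\<close>

lemma free_class_copies_0:
  assumes "pair_wf_digraph F"
  shows "free_class (copies 0 K1 \<oplus>\<^sub>D F) = free_class F"
  using assms
  by (auto simp: free_class_def free_of_iff oriented_digraph_wf wf_disj_union wf_copies wf_K1
      contains_copies_0)

lemma free_class_fewer_copies:
  "pair_wf_digraph F \<Longrightarrow> free_class (copies r K1 \<oplus>\<^sub>D F) \<subseteq> free_class (copies (Suc r) K1 \<oplus>\<^sub>D F)"
  by (auto simp: free_class_def free_of_iff oriented_digraph_wf wf_disj_union wf_copies wf_K1
      dest: contains_copies_Suc)

lemma hero_in_K1:
  assumes "pair_wf_digraph F"
  shows "hero_in K1 (free_class F)"
proof -
  have "V = {}" if "\<not> contains E V K1" "asym E" for E :: "nat rel" and V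
  proof (rule ccontr)
    assume "V \<noteq> {}"
    then obtain x where "x \<in> V" by blast
    moreover have "(x, x) \<notin> E" using asymD[OF that(2)] by blast
    ultimately have "contains E V K1"
      unfolding contains_def by (intro exI[of _ "\<lambda>_. x"]) (auto simp: K1_def)
    then show False using that(1) by blast
  qed
  then show ?thesis
    unfolding hero_in_free_class_iff[OF wf_K1 assms] by (metis acyclic_colourable_empty)
qed

text \<open>A copy of \<open>rK\<^sub>1 + F\<close> among the non-neighbours other than
  \<open>v\<close> would be extended by \<open>v\<close> itself. Putting \<open>v\<close> back takes
  one more colour, hence \<open>N + 1\<close>.\<close>

lemma sparse_nonneighboursI:
  assumes "finite V" "asym E" "\<not> contains E V (copies (Suc r) K1 \<oplus>\<^sub>D F)" "\<not> contains E V H"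
    and N: "\<And>W. finite W \<Longrightarrow> \<not> contains E W (copies r K1 \<oplus>\<^sub>D F) \<Longrightarrow> \<not> contains E W H \<Longrightarrow>
      acyclic_colourable E N W"
  shows "sparse_nonneighbours E V (N + 1)"
proof
  show "finite V" by fact
  show "(v, u) \<notin> E" if "(u, v) \<in> E" for u v using asymD[OF assms(2)] that by blast
  fix v assume v: "v \<in> V"
  define W where "W = {u \<in> V - {v}. (u, v) \<notin> E \<and> (v, u) \<notin> E}"
  have "acyclic_colourable E N W"
  proof (rule N)
    show "finite W" using assms(1) by (simp add: W_def)
    show "\<not> contains E W H" using assms(4) contains_mono[of E W H V] by (auto simp: W_def)
    show "\<not> contains E W (copies r K1 \<oplus>\<^sub>D F)"
    proof
      assume "contains E W (copies r K1 \<oplus>\<^sub>D F)"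
      then have "contains E (insert v W) (copies (Suc r) K1 \<oplus>\<^sub>D F)"
        by (rule contains_add_isolated) (use assms(2) in \<open>auto simp: W_def\<close>)
      moreover have "insert v W \<subseteq> V" using v by (auto simp: W_def)
      ultimately show False using contains_mono assms(3) by blast
    qed
  qed
  moreover have "acyclic_colourable E 1 {v}"
  proof -
    have "(v, v) \<notin> E" using asymD[OF assms(2)] by blast
    then have "Restr E {x \<in> {v}. 0 = i} = {}" for i :: nat by auto
    then show ?thesis
      unfolding acyclic_colourable_def by (intro exI[of _ "\<lambda>_. 0"]) (simp add: acyclic_def)
  qed
  ultimately have "acyclic_colourable E (N + 1) (W \<union> {v})" by (rule acyclic_colourable_Un)
  then show "acyclic_colourable E (N + 1) {u \<in> V. (u, v) \<notin> E \<and> (v, u) \<notin> E}"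
    by (rule acyclic_colourable_mono) (auto simp: W_def)
qed

lemma hero_in_dijoin:
  fixes H1 H2 :: "nat pair_pre_digraph"
  assumes F: "pair_wf_digraph F" and o: "oriented_digraph H1" "oriented_digraph H2"
    and hero: "hero_in H1 (free_class (copies (Suc r) K1 \<oplus>\<^sub>D F))"
      "hero_in H2 (free_class (copies (Suc r) K1 \<oplus>\<^sub>D F))"
      "hero_in (H1 \<Rightarrow>\<^sub>D H2) (free_class (copies r K1 \<oplus>\<^sub>D F))"
  shows "hero_in (H1 \<Rightarrow>\<^sub>D H2) (free_class (copies (Suc r) K1 \<oplus>\<^sub>D F))"
proof -
  define G where "G = copies (Suc r) K1 \<oplus>\<^sub>D F"
  define G0 where "G0 = copies r K1 \<oplus>\<^sub>D F"
  have wf: "pair_wf_digraph G" "pair_wf_digraph G0" "pair_wf_digraph H1" "pair_wf_digraph H2"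
    "pair_wf_digraph (H1 \<Rightarrow>\<^sub>D H2)"
    using F o by (simp_all add: G_def G0_def wf_disj_union wf_copies wf_K1 wf_dijoin oriented_digraph_wf)
  obtain c1 where c1: "\<And>(E :: nat rel) V. finite V \<Longrightarrow> asym E \<Longrightarrow> \<not> contains E V G \<Longrightarrow> \<not> contains E V H1 \<Longrightarrow>
      acyclic_colourable E c1 V"
    by (fact hero_in_free_classE[OF hero(1)[folded G_def] wf(3,1)])
  obtain c2 where c2: "\<And>(E :: nat rel) V. finite V \<Longrightarrow> asym E \<Longrightarrow> \<not> contains E V G \<Longrightarrow> \<not> contains E V H2 \<Longrightarrow>
      acyclic_colourable E c2 V"
    by (fact hero_in_free_classE[OF hero(2)[folded G_def] wf(4,1)])
  obtain N where N: "\<And>(E :: nat rel) V. finite V \<Longrightarrow> asym E \<Longrightarrow> \<not> contains E V G0 \<Longrightarrow> \<not> contains E V (H1 \<Rightarrow>\<^sub>D H2) \<Longrightarrow>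
      acyclic_colourable E N V"
    by (fact hero_in_free_classE[OF hero(3)[folded G0_def] wf(5,2)])
  define c where "c = max c1 c2"
  define h where "h = max (card (pverts H1)) (card (pverts H2))"
  define b where "b = mountain_bound c h (N + 1) (2 * c) +
    (mountain_size (2 * c) * (N + 1) + 2 ^ mountain_size (2 * c) * (2 * c))"
  have "acyclic_colourable E b V"
    if V: "finite V" "asym E" "\<not> contains E V G" "\<not> contains E V (H1 \<Rightarrow>\<^sub>D H2)" for E :: "nat rel" and V
  proof -
    interpret sparse_nonneighbours E V "N + 1"
      by (rule sparse_nonneighboursI[OF V(1,2) V(3)[unfolded G_def] V(4)])
        (rule N[OF _ V(2), unfolded G0_def])
    have sub: "finite S" "\<not> contains E S G" if "S \<subseteq> V" for S
      using finite_subset[OF that V(1)] contains_mono[OF _ that] V(3) by blast+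
    have H1: "contains E S H1" if "S \<subseteq> V" "\<not> acyclic_colourable E c S" for S
    proof (rule ccontr)
      assume "\<not> ?thesis"
      then have "acyclic_colourable E c1 S"
        using sub[OF that(1)] V(2) by (intro c1)
      then show False using that(2) acyclic_colourable_mono[of E c1 S S c] by (simp add: c_def)
    qed
    have H2: "contains E S H2" if "S \<subseteq> V" "\<not> acyclic_colourable E c S" for S
    proof (rule ccontr)
      assume "\<not> ?thesis"
      then have "acyclic_colourable E c2 S"
        using sub[OF that(1)] V(2) by (intro c2)
      then show False using that(2) acyclic_colourable_mono[of E c2 S S c] by (simp add: c_def)
    qed
    have join: False if "contains E A H1" "contains E B H2" "A \<times> B \<subseteq> E" "A \<subseteq> V" "B \<subseteq> V" for A B
      using contains_mono[OF contains_dijoin[OF that(1-3) V(2)], of V] that(4,5) V(4) by blast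
    interpret no_large_join E V "N + 1" c h
    proof
      fix S assume S: "S \<subseteq> V" "\<not> acyclic_colourable E c S"
      obtain X where X: "X \<subseteq> S" "card X \<le> card (pverts H2)" "contains E X H2"
        using contains_bounded_subset[OF H2[OF S]] o by (auto simp: oriented_digraph_iff)
      show "\<exists>X\<subseteq>S. card X \<le> h \<and> (\<forall>Y\<subseteq>V. Y \<times> X \<subseteq> E \<longrightarrow> acyclic_colourable E c Y)"
      proof (intro exI conjI allI impI)
        show "X \<subseteq> S" "card X \<le> h" using X by (auto simp: h_def)
        show "acyclic_colourable E c Y" if "Y \<subseteq> V" "Y \<times> X \<subseteq> E" for Y
          using join[OF H1 X(3)] that X(1) S(1) by blast
      qed
      obtain X where X: "X \<subseteq> S" "card X \<le> card (pverts H1)" "contains E X H1"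
        using contains_bounded_subset[OF H1[OF S]] o by (auto simp: oriented_digraph_iff)
      show "\<exists>X\<subseteq>S. card X \<le> h \<and> (\<forall>Y\<subseteq>V. X \<times> Y \<subseteq> E \<longrightarrow> acyclic_colourable E c Y)"
      proof (intro exI conjI allI impI)
        show "X \<subseteq> S" "card X \<le> h" using X by (auto simp: h_def)
        show "acyclic_colourable E c Y" if "Y \<subseteq> V" "X \<times> Y \<subseteq> E" for Y
          using join[OF X(3) H2] that X(1) S(1) by blast
      qed
    qed
    show ?thesis unfolding b_def by (rule colourable_V)
  qed
  then show ?thesis
    unfolding G_def[symmetric] hero_in_free_class_iff[OF wf(5,1)] by blast
qed

lemma hero_in_Delta:
  fixes H :: "nat pair_pre_digraph"
  assumes F: "pair_wf_digraph F" "localized F" "colocalized F" and o: "oriented_digraph H"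
    and hero: "hero_in H (free_class (copies (Suc r) K1 \<oplus>\<^sub>D F))"
      "hero_in (Delta K1 K1 H) (free_class (copies r K1 \<oplus>\<^sub>D F))"
  shows "hero_in (Delta K1 K1 H) (free_class (copies (Suc r) K1 \<oplus>\<^sub>D F))"
proof -
  define G where "G = copies (Suc r) K1 \<oplus>\<^sub>D F"
  define G0 where "G0 = copies r K1 \<oplus>\<^sub>D F"
  define H' where "H' = Delta K1 K1 H"
  have wf: "pair_wf_digraph G" "pair_wf_digraph G0" "pair_wf_digraph H" "pair_wf_digraph H'"
    using F(1) o
    by (simp_all add: G_def G0_def H'_def wf_disj_union wf_copies wf_K1 wf_Delta oriented_digraph_wf)
  obtain c where c: "\<And>(E :: nat rel) V. finite V \<Longrightarrow> asym E \<Longrightarrow> \<not> contains E V G \<Longrightarrow> \<not> contains E V H \<Longrightarrow>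
      acyclic_colourable E c V"
    by (fact hero_in_free_classE[OF hero(1)[folded G_def] wf(3,1)])
  obtain N where N: "\<And>(E :: nat rel) V. finite V \<Longrightarrow> asym E \<Longrightarrow> \<not> contains E V G0 \<Longrightarrow> \<not> contains E V H' \<Longrightarrow>
      acyclic_colourable E N V"
    by (fact hero_in_free_classE[OF hero(2)[folded G0_def H'_def] wf(4,2)])
  \<comment> \<open>Localization speaks of \<open>k \<ge> 1\<close>, while
    \<open>small_triangles\<close> wants a bound for every \<open>k\<close>; a
    \<open>k\<close>-colouring is also a \<open>Suc k\<close>-colouring.\<close>
  have "hero_in H' {D \<in> free_class G. k_local (Suc k) D}" for k
    using F(2)[unfolded localized_def, rule_format, of "Suc r" H "Suc k"] o hero
    by (simp add: G_def H'_def)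
  then have "\<forall>k. \<exists>c. \<forall>(E :: nat rel) V. finite V \<longrightarrow> asym E \<longrightarrow>
      (\<forall>v\<in>V. acyclic_colourable E (Suc k) {u \<in> V. (v, u) \<in> E}) \<longrightarrow>
       \<not> contains E V G \<longrightarrow> \<not> contains E V H' \<longrightarrow> acyclic_colourable E c V"
    unfolding hero_in_k_local_iff[OF wf(4,1)] ..
  from choice[OF this] obtain l where l: "\<forall>k. \<forall>(E :: nat rel) V. finite V \<longrightarrow> asym E \<longrightarrow>
      (\<forall>v\<in>V. acyclic_colourable E (Suc k) {u \<in> V. (v, u) \<in> E}) \<longrightarrow>
       \<not> contains E V G \<longrightarrow> \<not> contains E V H' \<longrightarrow> acyclic_colourable E (l k) V" ..
  have "hero_in H' {D \<in> free_class G. k_colocal (Suc k) D}" for k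
    using F(3)[unfolded colocalized_def, rule_format, of "Suc r" H "Suc k"] o hero
    by (simp add: G_def H'_def)
  then have "\<forall>k. \<exists>c. \<forall>(E :: nat rel) V. finite V \<longrightarrow> asym E \<longrightarrow>
      (\<forall>v\<in>V. acyclic_colourable E (Suc k) {u \<in> V. (u, v) \<in> E}) \<longrightarrow>
       \<not> contains E V G \<longrightarrow> \<not> contains E V H' \<longrightarrow> acyclic_colourable E c V"
    unfolding hero_in_k_colocal_iff[OF wf(4,1)] ..
  from choice[OF this] obtain l' where l': "\<forall>k. \<forall>(E :: nat rel) V. finite V \<longrightarrow> asym E \<longrightarrow>
      (\<forall>v\<in>V. acyclic_colourable E (Suc k) {u \<in> V. (u, v) \<in> E}) \<longrightarrow>
       \<not> contains E V G \<longrightarrow> \<not> contains E V H' \<longrightarrow> acyclic_colourable E (l' k) V" ..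
  define L where "L k = max (l k) (l' k)" for k
  \<comment> \<open>This is \<open>bag_bound\<close> for \<open>N + 1\<close>, spelled out because
    the bound must be fixed before \<open>E\<close> and \<open>V\<close>.\<close>
  define b where "b = max (L c) (4 * c + 3 * (N + 1))"
  have "acyclic_colourable E (2 * (2 * L (2 * L b + b))) V"
    if V: "finite V" "asym E" "\<not> contains E V G" "\<not> contains E V H'" for E :: "nat rel" and V
  proof -
    interpret sparse_nonneighbours E V "N + 1"
      by (rule sparse_nonneighboursI[OF V(1,2) V(3)[unfolded G_def] V(4)])
        (rule N[OF _ V(2), unfolded G0_def])
    have sub: "finite S" "\<not> contains E S G" "\<not> contains E S H'" if "S \<subseteq> V" for S
      using finite_subset[OF that V(1)] contains_mono[OF _ that] V(3,4) by blast+
    interpret small_triangles E V "N + 1" c L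
    proof
      fix u v assume uv: "u \<in> V" "v \<in> V" "(u, v) \<in> E"
      have sV: "tri u v \<subseteq> V" by (auto simp: tri_def)
      show "acyclic_colourable E c (tri u v)"
      proof (rule c)
        show "finite (tri u v)" "asym E" "\<not> contains E (tri u v) G" using sub[OF sV] V(2) by auto
        show "\<not> contains E (tri u v) H"
        proof
          assume "contains E (tri u v) H"
          then have "contains E ({u, v} \<union> tri u v) H'"
            unfolding H'_def using uv(3) V(2) by (intro contains_Delta) (auto simp: tri_def)
          then show False using contains_mono[of E _ H' V] uv sV V(4) by blast
        qed
      qed
    next
      fix S k assume S: "S \<subseteq> V" "\<And>v. v \<in> S \<Longrightarrow> acyclic_colourable E k {u \<in> S. (v, u) \<in> E}"
      have "acyclic_colourable E (l k) S"
        using sub[OF S(1)] V(2) acyclic_colourable_mono[OF S(2) subset_refl, of _ "Suc k"]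
        by (intro l[rule_format]) auto
      then show "acyclic_colourable E (L k) S"
        by (rule acyclic_colourable_mono) (auto simp: L_def)
    next
      fix S k assume S: "S \<subseteq> V" "\<And>v. v \<in> S \<Longrightarrow> acyclic_colourable E k {u \<in> S. (u, v) \<in> E}"
      have "acyclic_colourable E (l' k) S"
        using sub[OF S(1)] V(2) acyclic_colourable_mono[OF S(2) subset_refl, of _ "Suc k"]
        by (intro l'[rule_format]) auto
      then show "acyclic_colourable E (L k) S"
        by (rule acyclic_colourable_mono) (auto simp: L_def)
    qed
    show ?thesis unfolding b_def using colourable_V by (simp only: bag_bound_def)
  qed
  then show ?thesis
    unfolding G_def[symmetric] H'_def[symmetric] hero_in_free_class_iff[OF wf(4,1)] by blast
qed

theorem theorem3p2:
  fixes F :: "'a pair_pre_digraph" and r :: nat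
  assumes "oriented_digraph F"
    and "localized F"
    and "colocalized F"
    and "cooperates F"
  shows "cooperates (copies r K1 \<oplus>\<^sub>D F)"
proof (induction r)
  case 0
  \<comment> \<open>\<open>copies 0 K1 \<oplus>\<^sub>D F\<close> has another vertex type than
    \<open>F\<close>, but \<open>cooperates\<close> depends only on the class of free digraphs, and
    the two classes agree.\<close>
  then show ?case
    using assms(4) free_class_copies_0[OF oriented_digraph_wf[OF assms(1)]]
    by (simp add: cooperates_def)
next
  case (Suc r)
  have F: "pair_wf_digraph F" using assms(1) by (rule oriented_digraph_wf)
  \<comment> \<open>Heroes pass to the smaller class for \<open>r\<close>, so the induction
    hypothesis applies to the constituents and makes the join or triangle a hero there; this is what
    bounds the non-neighbourhoods.\<close>
  have fewer: "hero_in H (free_class (copies r K1 \<oplus>\<^sub>D F))"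
    if "hero_in H (free_class (copies (Suc r) K1 \<oplus>\<^sub>D F))" for H :: "nat pair_pre_digraph"
    using that free_class_fewer_copies[OF F, of r] unfolding hero_in_def by (meson subsetD)
  show ?case
    unfolding cooperates_def
  proof (intro conjI allI impI; (elim conjE)?)
    show "hero_in K1 (free_class (copies (Suc r) K1 \<oplus>\<^sub>D F))"
      using F by (intro hero_in_K1 wf_disj_union wf_copies wf_K1)
  next
    fix H1 H2 :: "nat pair_pre_digraph"
    assume "oriented_digraph H1" "oriented_digraph H2"
      "hero_in H1 (free_class (copies (Suc r) K1 \<oplus>\<^sub>D F))"
      "hero_in H2 (free_class (copies (Suc r) K1 \<oplus>\<^sub>D F))"
    then show "hero_in (H1 \<Rightarrow>\<^sub>D H2) (free_class (copies (Suc r) K1 \<oplus>\<^sub>D F))"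
      using F Suc.IH fewer by (intro hero_in_dijoin) (auto simp: cooperates_def)
  next
    fix H :: "nat pair_pre_digraph"
    assume "oriented_digraph H" "hero_in H (free_class (copies (Suc r) K1 \<oplus>\<^sub>D F))"
    then show "hero_in (Delta K1 K1 H) (free_class (copies (Suc r) K1 \<oplus>\<^sub>D F))"
      using F assms(2,3) Suc.IH fewer by (intro hero_in_Delta) (auto simp: cooperates_def)
  qed
qed

end
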